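(* Let $\mathbb{D}$ be a skew monoidal closed category. Given a function $F_{\mathsf{At}} : \mathsf{At} \to |\mathbb{D}|$ from a set $\mathsf{At}$ of atoms, providing evaluation of atomic formulae as objects of $\mathbb{D}$, there exists a (strict) skew monoidal closed functor $F : \mathsf{FSkMCl}(\mathsf{At}) \to \mathbb{D}$.
   Context: **Skew monoidal closed categories.** A (left) skew monoidal closed category is a category $\mathbb{C}$ with a unit object $\mathsf{I}$ and two functors $\otimes : \mathbb{C} \times \mathbb{C} \to \mathbb{C}$ and $\multimap : \mathbb{C}^{\mathsf{op}} \times \mathbb{C} \to \mathbb{C}$ forming an adjunction ${-} \otimes B \dashv B \multimap {-}$ for all $B$, and three natural transformations (not required invertible) $\lambda_A : \mathsf{I} \otimes A \to A$, $\rho_A : A \to A \otimes \mathsf{I}$, $\alpha_{A,B,C} : (A \otimes B) \otimes C \to A \otimes (B \otimes C)$ such that (1) $\lambda_{\mathsf{I}} \circ \rho_{\mathsf{I}} = \mathrm{id}$; (2) $(A \otimes \lambda_B) \circ \alpha_{A,\mathsf{I},B} \circ (\rho_A \otimes B) = \mathrm{id}_{A \otimes B}$; (3) $\lambda_{A \otimes B} \circ \alpha_{\mathsf{I},A,B} = \lambda_A \otimes B$; (4) $\alpha_{A,B,\mathsf{I}} \circ \rho_{A \otimes B} = A \otimes \rho_B$; (5) $(A \otimes \alpha_{B,C,D}) \circ \alpha_{A, B \otimes C, D} \circ (\alpha_{A,B,C} \otimes D) = \alpha_{A,B,C \otimes D} \circ \alpha_{A \otimes B, C, D}$. A (strict)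 skew monoidal closed functor $F : \mathbb{C} \to \mathbb{D}$ between skew monoidal closed categories $(\mathbb{C}, \mathsf{I}, \otimes, \multimap)$ and $(\mathbb{D}, \mathsf{I}', \otimes', \multimap')$ is a functor from $\mathbb{C}$ to $\mathbb{D}$ satisfying $F\mathsf{I} = \mathsf{I}'$, $F(A \otimes B) = FA \otimes' FB$ and $F(A \multimap B) = FA \multimap' FB$, also preserving the structural laws $\lambda$, $\rho$ and $\alpha$ on the nose. **Sequent calculus.** Formulae are generated by $A, B ::= X \mid \mathsf{I} \mid A \otimes B \mid A \multimap B$ with $X \in \mathsf{At}$. A stoup $S$ is either empty (${-}$) or a single formula; a context $\Gamma$ is a finite ordered list of formulae; a sequent is a triple $S \mid \Gamma \vdash A$. Derivations are inductively generated by (premises $\Longrightarrow$ conclusion): - $\mathsf{ax}_A$: $\Longrightarrow A \mid \ \vdash A$; - $\mathsf{pass}$: $A \mid \Gamma \vdash C \Longrightarrow {-} \mid A, \Gamma \vdash C$; - ${\multimap}\mathsf{L}$: ${-} \mid \Gamma \vdash A$ and $B \mid \Delta \vdash C \Longrightarrow A \multimap B \mid \Gamma, \Delta \vdash C$; - ${\multimap}\mathsf{R}$: $S \mid \Gamma, A \vdash B \Longrightarrow S \mid \Gamma \vdash A \multimap B$; - $\mathsf{IL}$: ${-} \mid \Gamma \vdash C \Longrightarrow \mathsf{I} \mid \Gamma \vdash C$; - $\otimes\mathsf{L}$: $A \mid B, \Gamma \vdash C \Longrightarrow A \otimes B \mid \Gamma \vdash C$; - $\mathsf{IR}$: $\Longrightarrow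 {-} \mid \ \vdash \mathsf{I}$; - $\otimes\mathsf{R}$: $S \mid \Gamma \vdash A$ and ${-} \mid \Delta \vdash B \Longrightarrow S \mid \Gamma, \Delta \vdash A \otimes B$. **The congruence $\circeq$** is the smallest family of equivalence relations on derivations of the same sequent that is compatible with all rules and contains (for all well-typed $f,g,h$) $\mathsf{ax}_{\mathsf{I}} \circeq \mathsf{IL}(\mathsf{IR})$; $\mathsf{ax}_{A \otimes B} \circeq \otimes\mathsf{L}(\otimes\mathsf{R}(\mathsf{ax}_A, \mathsf{pass}\,\mathsf{ax}_B))$; $\mathsf{ax}_{A \multimap B} \circeq {\multimap}\mathsf{R}({\multimap}\mathsf{L}(\mathsf{pass}\,\mathsf{ax}_A, \mathsf{ax}_B))$; $\otimes\mathsf{R}(\mathsf{pass} f, g) \circeq \mathsf{pass}(\otimes\mathsf{R}(f,g))$; $\otimes\mathsf{R}(\mathsf{IL} f, g) \circeq \mathsf{IL}(\otimes\mathsf{R}(f,g))$; $\otimes\mathsf{R}(\otimes\mathsf{L} f, g) \circeq \otimes\mathsf{L}(\otimes\mathsf{R}(f,g))$; $\otimes\mathsf{R}({\multimap}\mathsf{L}(f,g), h) \circeq {\multimap}\mathsf{L}(f, \otimes\mathsf{R}(g,h))$; $\mathsf{pass}({\multimap}\mathsf{R} f) \circeq {\multimap}\mathsf{R}(\mathsf{pass} f)$; $\mathsf{IL}({\multimap}\mathsf{R} f) \circeq {\multimap}\mathsf{R}(\mathsf{IL} f)$; $\otimes\mathsf{L}({\multimap}\mathsf{R} f) \circeq {\multimap}\mathsf{R}(\otimes\mathsf{L}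 f)$; ${\multimap}\mathsf{L}(f, {\multimap}\mathsf{R} g) \circeq {\multimap}\mathsf{R}({\multimap}\mathsf{L}(f,g))$. **Cut.** The operations $\mathsf{scut}$ (from $f: S \mid \Gamma \vdash A$ and $g : A \mid \Delta \vdash C$ to $S \mid \Gamma, \Delta \vdash C$) and $\mathsf{ccut}$ (from $f : {-} \mid \Gamma \vdash A$ and $g : S \mid \Delta_0, A, \Delta_1 \vdash C$ to $S \mid \Delta_0, \Gamma, \Delta_1 \vdash C$) are defined by mutual recursion: - $\mathsf{scut}(\mathsf{ax}, g) = g$; $\mathsf{scut}(\mathsf{pass} f, g) = \mathsf{pass}(\mathsf{scut}(f,g))$, similarly for $\mathsf{IL}, \otimes\mathsf{L}$; $\mathsf{scut}({\multimap}\mathsf{L}(f,f'), g) = {\multimap}\mathsf{L}(f, \mathsf{scut}(f',g))$. - If $f$ ends with a right rule ($\mathsf{IR}$, $\otimes\mathsf{R}$, ${\multimap}\mathsf{R}$): $\mathsf{scut}(f, \mathsf{ax}) = f$; $\mathsf{scut}(f, \otimes\mathsf{R}(g_1,g_2)) = \otimes\mathsf{R}(\mathsf{scut}(f,g_1), g_2)$; $\mathsf{scut}(f, {\multimap}\mathsf{R} g) = {\multimap}\mathsf{R}(\mathsf{scut}(f,g))$; and the principal cases are $\mathsf{scut}(\mathsf{IR}, \mathsf{IL}\, g) = g$, $\mathsf{scut}(\otimes\mathsf{R}(f_1,f_2), \otimes\mathsf{L}\, g) = \mathsf{scut}(f_1, \mathsf{ccut}(f_2, g))$, $\mathsf{scut}({\multimap}\mathsf{R}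 f, {\multimap}\mathsf{L}(g_1,g_2)) = \mathsf{scut}(\mathsf{ccut}(g_1, f), g_2)$. - $\mathsf{ccut}(f, \mathsf{pass}\, g) = \mathsf{scut}(f,g)$ if $\Delta_0$ is empty (the passivated formula is the cut formula); in all other cases $\mathsf{ccut}(f,g)$ permutes past the last rule of $g$ into the premise whose context contains the cut formula occurrence. **The category $\mathsf{FSkMCl}(\mathsf{At})$.** Objects are formulae; maps $A \to B$ are derivations of $A \mid \ \vdash B$ modulo $\circeq$; the identity on $A$ is $[\mathsf{ax}_A]$; the composite of $f : A \mid \ \vdash B$ followed by $g : B \mid \ \vdash C$ is $[\mathsf{scut}(f,g)]$. The operations $\mathsf{I}$, $\otimes$, $\multimap$ on objects are the logical connectives. On maps, $f \otimes g = \otimes\mathsf{L}(\otimes\mathsf{R}(f, \mathsf{pass}\, g))$ and $f \multimap g = {\multimap}\mathsf{R}({\multimap}\mathsf{L}(\mathsf{pass} f, g))$. The adjunction sends $f : A \otimes B \to C$ to ${\multimap}\mathsf{R}(\mathsf{scut}(\otimes\mathsf{R}(\mathsf{ax}_A, \mathsf{pass}\,\mathsf{ax}_B), f)) : A \to B \multimap C$, with inverse sending $g : A \to B \multimap C$ to $\otimes\mathsf{L}(\mathsf{scut}(g, {\multimap}\mathsf{L}(\mathsf{pass}\,\mathsf{ax}_B, \mathsf{ax}_C)))$. The structural laws are $\lambda_A = \otimes\mathsf{L}(\mathsf{IL}(\mathsf{pass}\,\mathsf{ax}_A))$, $\rho_A = \otimes\mathsf{R}(\mathsf{ax}_A, \mathsf{IR})$,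 $\alpha_{A,B,C} = \otimes\mathsf{L}(\otimes\mathsf{L}(\otimes\mathsf{R}(\mathsf{ax}_A, \mathsf{pass}(\otimes\mathsf{R}(\mathsf{ax}_B, \mathsf{pass}\,\mathsf{ax}_C)))))$. With this structure $\mathsf{FSkMCl}(\mathsf{At})$ is a skew monoidal closed category. *)

theory Defs
  imports Main
begin

section \<open>Skew monoidal closed categories\<close>

text \<open>
  A category is given by a set of objects and a family of hom-sets.  The hom-sets need not be
  disjoint; operations on maps whose type does not show up in the map itself
  (transposition along the adjunction) take the objects as arguments.
\<close>

record ('o, 'm) skmc =
  Obj :: "'o set"
  Hom :: "'o \<Rightarrow> 'o \<Rightarrow> 'm set"
  Id :: "'o \<Rightarrow> 'm"
  Comp :: "'m \<Rightarrow> 'm \<Rightarrow> 'm"  (infixr "\<cdot>\<index>" 60)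
  UnitO :: "'o"  ("\<one>\<index>")
  TensO :: "'o \<Rightarrow> 'o \<Rightarrow> 'o"  (infixr "\<otimes>\<index>" 70)
  TensM :: "'m \<Rightarrow> 'm \<Rightarrow> 'm"  (infixr "\<otimes>\<^sub>m\<index>" 70)
  LolliO :: "'o \<Rightarrow> 'o \<Rightarrow> 'o"  (infixr "-\<circ>\<index>" 65)
  LolliM :: "'m \<Rightarrow> 'm \<Rightarrow> 'm"  (infixr "-\<circ>\<^sub>m\<index>" 65)
  Curry :: "'o \<Rightarrow> 'o \<Rightarrow> 'o \<Rightarrow> 'm \<Rightarrow> 'm"
  Uncurry :: "'o \<Rightarrow> 'o \<Rightarrow> 'o \<Rightarrow> 'm \<Rightarrow> 'm"
  Lam :: "'o \<Rightarrow> 'm"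
  Rho :: "'o \<Rightarrow> 'm"
  Alpha :: "'o \<Rightarrow> 'o \<Rightarrow> 'o \<Rightarrow> 'm"

locale category =
  fixes C :: "('o, 'm) skmc" (structure)
  assumes id_hom: "A \<in> Obj C \<Longrightarrow> Id C A \<in> Hom C A A"
    and comp_hom: "\<lbrakk>A \<in> Obj C; B \<in> Obj C; D \<in> Obj C; f \<in> Hom C A B; g \<in> Hom C B D\<rbrakk>
      \<Longrightarrow> g \<cdot> f \<in> Hom C A D"
    and comp_id_left: "\<lbrakk>A \<in> Obj C; B \<in> Obj C; f \<in> Hom C A B\<rbrakk> \<Longrightarrow> Id C B \<cdot> f = f"
    and comp_id_right: "\<lbrakk>A \<in> Obj C; B \<in> Obj C; f \<in> Hom C A B\<rbrakk> \<Longrightarrow> f \<cdot> Id C A = f"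
    and comp_assoc: "\<lbrakk>A \<in> Obj C; B \<in> Obj C; D \<in> Obj C; E \<in> Obj C;
        f \<in> Hom C A B; g \<in> Hom C B D; h \<in> Hom C D E\<rbrakk> \<Longrightarrow> (h \<cdot> g) \<cdot> f = h \<cdot> (g \<cdot> f)"

locale skew_monoidal_category = category +
  assumes unit_obj: "\<one> \<in> Obj C"
    and tens_obj: "\<lbrakk>A \<in> Obj C; B \<in> Obj C\<rbrakk> \<Longrightarrow> A \<otimes> B \<in> Obj C"
    and tens_hom: "\<lbrakk>A \<in> Obj C; A' \<in> Obj C; B \<in> Obj C; B' \<in> Obj C; f \<in> Hom C A A'; g \<in> Hom C B B'\<rbrakk>
      \<Longrightarrow> f \<otimes>\<^sub>m g \<in> Hom C (A \<otimes> B) (A' \<otimes> B')"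
    and tens_id: "\<lbrakk>A \<in> Obj C; B \<in> Obj C\<rbrakk> \<Longrightarrow> Id C A \<otimes>\<^sub>m Id C B = Id C (A \<otimes> B)"
    and tens_comp: "\<lbrakk>A \<in> Obj C; A' \<in> Obj C; A'' \<in> Obj C; B \<in> Obj C; B' \<in> Obj C; B'' \<in> Obj C;
        f \<in> Hom C A A'; f' \<in> Hom C A' A''; g \<in> Hom C B B'; g' \<in> Hom C B' B''\<rbrakk>
      \<Longrightarrow> (f' \<cdot> f) \<otimes>\<^sub>m (g' \<cdot> g) = (f' \<otimes>\<^sub>m g') \<cdot> (f \<otimes>\<^sub>m g)"
    and lam_hom: "A \<in> Obj C \<Longrightarrow> Lam C A \<in> Hom C (\<one> \<otimes> A) A"
    and lam_natural: "\<lbrakk>A \<in> Obj C; B \<in> Obj C; f \<in> Hom C A B\<rbrakk>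
      \<Longrightarrow> Lam C B \<cdot> (Id C \<one> \<otimes>\<^sub>m f) = f \<cdot> Lam C A"
    and rho_hom: "A \<in> Obj C \<Longrightarrow> Rho C A \<in> Hom C A (A \<otimes> \<one>)"
    and rho_natural: "\<lbrakk>A \<in> Obj C; B \<in> Obj C; f \<in> Hom C A B\<rbrakk>
      \<Longrightarrow> Rho C B \<cdot> f = (f \<otimes>\<^sub>m Id C \<one>) \<cdot> Rho C A"
    and alpha_hom: "\<lbrakk>A \<in> Obj C; B \<in> Obj C; D \<in> Obj C\<rbrakk>
      \<Longrightarrow> Alpha C A B D \<in> Hom C ((A \<otimes> B) \<otimes> D) (A \<otimes> (B \<otimes> D))"
    and alpha_natural: "\<lbrakk>A \<in> Obj C; A' \<in> Obj C; B \<in> Obj C; B' \<in> Obj C; D \<in> Obj C; D' \<in> Obj C;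
        f \<in> Hom C A A'; g \<in> Hom C B B'; h \<in> Hom C D D'\<rbrakk>
      \<Longrightarrow> Alpha C A' B' D' \<cdot> ((f \<otimes>\<^sub>m g) \<otimes>\<^sub>m h) = (f \<otimes>\<^sub>m (g \<otimes>\<^sub>m h)) \<cdot> Alpha C A B D"
    and lam_rho: "Lam C \<one> \<cdot> Rho C \<one> = Id C \<one>"
    and lam_alpha_rho: "\<lbrakk>A \<in> Obj C; B \<in> Obj C\<rbrakk>
      \<Longrightarrow> (Id C A \<otimes>\<^sub>m Lam C B) \<cdot> Alpha C A \<one> B \<cdot> (Rho C A \<otimes>\<^sub>m Id C B) = Id C (A \<otimes> B)"
    and lam_alpha: "\<lbrakk>A \<in> Obj C; B \<in> Obj C\<rbrakk> \<Longrightarrow> Lam C (A \<otimes> B) \<cdot> Alpha C \<one> A B = Lam C A \<otimes>\<^sub>m Id C B"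
    and alpha_rho: "\<lbrakk>A \<in> Obj C; B \<in> Obj C\<rbrakk> \<Longrightarrow> Alpha C A B \<one> \<cdot> Rho C (A \<otimes> B) = Id C A \<otimes>\<^sub>m Rho C B"
    and pentagon: "\<lbrakk>A \<in> Obj C; B \<in> Obj C; D \<in> Obj C; E \<in> Obj C\<rbrakk>
      \<Longrightarrow> (Id C A \<otimes>\<^sub>m Alpha C B D E) \<cdot> Alpha C A (B \<otimes> D) E \<cdot> (Alpha C A B D \<otimes>\<^sub>m Id C E)
        = Alpha C A B (D \<otimes> E) \<cdot> Alpha C (A \<otimes> B) D E"

text \<open>
  The bijections between maps from \<open>A \<otimes> B\<close> to \<open>D\<close> and maps from \<open>A\<close> to \<open>B -\<circ> D\<close> are natural in
  all three objects.  Naturality in \<open>B\<close> is what ties the contravariant action of the internal hom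
  on maps to the adjunctions.
\<close>

locale skew_monoidal_closed_category = skew_monoidal_category +
  assumes lolli_obj: "\<lbrakk>A \<in> Obj C; B \<in> Obj C\<rbrakk> \<Longrightarrow> A -\<circ> B \<in> Obj C"
    and lolli_hom: "\<lbrakk>A \<in> Obj C; A' \<in> Obj C; B \<in> Obj C; B' \<in> Obj C; f \<in> Hom C A' A; g \<in> Hom C B B'\<rbrakk>
      \<Longrightarrow> f -\<circ>\<^sub>m g \<in> Hom C (A -\<circ> B) (A' -\<circ> B')"
    and lolli_id: "\<lbrakk>A \<in> Obj C; B \<in> Obj C\<rbrakk> \<Longrightarrow> Id C A -\<circ>\<^sub>m Id C B = Id C (A -\<circ> B)"
    and lolli_comp: "\<lbrakk>A \<in> Obj C; A' \<in> Obj C; A'' \<in> Obj C; B \<in> Obj C; B' \<in> Obj C; B'' \<in> Obj C;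
        f \<in> Hom C A' A; f' \<in> Hom C A'' A'; g \<in> Hom C B B'; g' \<in> Hom C B' B''\<rbrakk>
      \<Longrightarrow> (f \<cdot> f') -\<circ>\<^sub>m (g' \<cdot> g) = (f' -\<circ>\<^sub>m g') \<cdot> (f -\<circ>\<^sub>m g)"
    and curry_hom: "\<lbrakk>A \<in> Obj C; B \<in> Obj C; D \<in> Obj C; f \<in> Hom C (A \<otimes> B) D\<rbrakk>
      \<Longrightarrow> Curry C A B D f \<in> Hom C A (B -\<circ> D)"
    and uncurry_hom: "\<lbrakk>A \<in> Obj C; B \<in> Obj C; D \<in> Obj C; g \<in> Hom C A (B -\<circ> D)\<rbrakk>
      \<Longrightarrow> Uncurry C A B D g \<in> Hom C (A \<otimes> B) D"
    and uncurry_curry: "\<lbrakk>A \<in> Obj C; B \<in> Obj C; D \<in> Obj C; f \<in> Hom C (A \<otimes> B) D\<rbrakk>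
      \<Longrightarrow> Uncurry C A B D (Curry C A B D f) = f"
    and curry_uncurry: "\<lbrakk>A \<in> Obj C; B \<in> Obj C; D \<in> Obj C; g \<in> Hom C A (B -\<circ> D)\<rbrakk>
      \<Longrightarrow> Curry C A B D (Uncurry C A B D g) = g"
    and curry_natural: "\<lbrakk>A \<in> Obj C; A' \<in> Obj C; B \<in> Obj C; B' \<in> Obj C; D \<in> Obj C; D' \<in> Obj C;
        a \<in> Hom C A' A; b \<in> Hom C B' B; d \<in> Hom C D D'; f \<in> Hom C (A \<otimes> B) D\<rbrakk>
      \<Longrightarrow> Curry C A' B' D' (d \<cdot> f \<cdot> (a \<otimes>\<^sub>m b)) = (b -\<circ>\<^sub>m d) \<cdot> Curry C A B D f \<cdot> a"

definition strict_skew_monoidal_closed_functor ::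
    "('o, 'm) skmc \<Rightarrow> ('p, 'n) skmc \<Rightarrow> ('o \<Rightarrow> 'p) \<Rightarrow> ('m \<Rightarrow> 'n) \<Rightarrow> bool" where
  "strict_skew_monoidal_closed_functor C D Fo Fm \<longleftrightarrow>
    (\<forall>A\<in>Obj C. Fo A \<in> Obj D) \<and>
    (\<forall>A\<in>Obj C. \<forall>B\<in>Obj C. \<forall>f\<in>Hom C A B. Fm f \<in> Hom D (Fo A) (Fo B)) \<and>
    (\<forall>A\<in>Obj C. Fm (Id C A) = Id D (Fo A)) \<and>
    (\<forall>A\<in>Obj C. \<forall>B\<in>Obj C. \<forall>E\<in>Obj C. \<forall>f\<in>Hom C A B. \<forall>g\<in>Hom C B E.
       Fm (g \<cdot>\<^bsub>C\<^esub> f) = Fm g \<cdot>\<^bsub>D\<^esub> Fm f) \<and>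
    Fo (UnitO C) = UnitO D \<and>
    (\<forall>A\<in>Obj C. \<forall>B\<in>Obj C. Fo (A \<otimes>\<^bsub>C\<^esub> B) = Fo A \<otimes>\<^bsub>D\<^esub> Fo B) \<and>
    (\<forall>A\<in>Obj C. \<forall>A'\<in>Obj C. \<forall>B\<in>Obj C. \<forall>B'\<in>Obj C. \<forall>f\<in>Hom C A A'. \<forall>g\<in>Hom C B B'.
       Fm (f \<otimes>\<^sub>m\<^bsub>C\<^esub> g) = Fm f \<otimes>\<^sub>m\<^bsub>D\<^esub> Fm g) \<and>
    (\<forall>A\<in>Obj C. \<forall>B\<in>Obj C. Fo (A -\<circ>\<^bsub>C\<^esub> B) = Fo A -\<circ>\<^bsub>D\<^esub> Fo B) \<and>
    (\<forall>A\<in>Obj C. \<forall>A'\<in>Obj C. \<forall>B\<in>Obj C. \<forall>B'\<in>Obj C. \<forall>f\<in>Hom C A' A. \<forall>g\<in>Hom C B B'.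
       Fm (f -\<circ>\<^sub>m\<^bsub>C\<^esub> g) = Fm f -\<circ>\<^sub>m\<^bsub>D\<^esub> Fm g) \<and>
    (\<forall>A\<in>Obj C. Fm (Lam C A) = Lam D (Fo A)) \<and>
    (\<forall>A\<in>Obj C. Fm (Rho C A) = Rho D (Fo A)) \<and>
    (\<forall>A\<in>Obj C. \<forall>B\<in>Obj C. \<forall>E\<in>Obj C. Fm (Alpha C A B E) = Alpha D (Fo A) (Fo B) (Fo E))"


section \<open>The sequent calculus\<close>

datatype 'x fma =
    Atom 'x
  | Unit
  | Tens "'x fma" "'x fma"
  | Lolli "'x fma" "'x fma"

text \<open>
  Derivation trees are represented by raw terms together with a typing judgement.  Annotating
  axioms with their formula is enough for a raw term to determine its sequent (if it has one) and
  the whole derivation tree.  The stoup is \<open>None\<close> when empty.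
\<close>

datatype 'x deriv =
    Ax "'x fma"
  | Pass "'x deriv"
  | LolliL "'x deriv" "'x deriv"
  | LolliR "'x deriv"
  | IL "'x deriv"
  | TensL "'x deriv"
  | IR
  | TensR "'x deriv" "'x deriv"

inductive derives :: "'x deriv \<Rightarrow> 'x fma option \<Rightarrow> 'x fma list \<Rightarrow> 'x fma \<Rightarrow> bool" where
  ax: "derives (Ax A) (Some A) [] A"
| pass: "derives f (Some A) \<Gamma> C \<Longrightarrow> derives (Pass f) None (A # \<Gamma>) C"
| lolliL: "\<lbrakk>derives f None \<Gamma> A; derives g (Some B) \<Delta> C\<rbrakk>
    \<Longrightarrow> derives (LolliL f g) (Some (Lolli A B)) (\<Gamma> @ \<Delta>) C"
| lolliR: "derives f S (\<Gamma> @ [A]) B \<Longrightarrow> derives (LolliR f) S \<Gamma> (Lolli A B)"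
| IL: "derives f None \<Gamma> C \<Longrightarrow> derives (IL f) (Some Unit) \<Gamma> C"
| tensL: "derives f (Some A) (B # \<Gamma>) C \<Longrightarrow> derives (TensL f) (Some (Tens A B)) \<Gamma> C"
| IR: "derives IR None [] Unit"
| tensR: "\<lbrakk>derives f S \<Gamma> A; derives g None \<Delta> B\<rbrakk> \<Longrightarrow> derives (TensR f g) S (\<Gamma> @ \<Delta>) (Tens A B)"

inductive ceq :: "'x fma option \<Rightarrow> 'x fma list \<Rightarrow> 'x fma \<Rightarrow> 'x deriv \<Rightarrow> 'x deriv \<Rightarrow> bool" where
  refl: "derives f S \<Gamma> C \<Longrightarrow> ceq S \<Gamma> C f f"
| sym: "ceq S \<Gamma> C f g \<Longrightarrow> ceq S \<Gamma> C g f"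
| trans: "\<lbrakk>ceq S \<Gamma> C f g; ceq S \<Gamma> C g h\<rbrakk> \<Longrightarrow> ceq S \<Gamma> C f h"
| cong_pass: "ceq (Some A) \<Gamma> C f f' \<Longrightarrow> ceq None (A # \<Gamma>) C (Pass f) (Pass f')"
| cong_lolliL: "\<lbrakk>ceq None \<Gamma> A f f'; ceq (Some B) \<Delta> C g g'\<rbrakk>
    \<Longrightarrow> ceq (Some (Lolli A B)) (\<Gamma> @ \<Delta>) C (LolliL f g) (LolliL f' g')"
| cong_lolliR: "ceq S (\<Gamma> @ [A]) B f f' \<Longrightarrow> ceq S \<Gamma> (Lolli A B) (LolliR f) (LolliR f')"
| cong_IL: "ceq None \<Gamma> C f f' \<Longrightarrow> ceq (Some Unit) \<Gamma> C (IL f) (IL f')"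
| cong_tensL: "ceq (Some A) (B # \<Gamma>) C f f' \<Longrightarrow> ceq (Some (Tens A B)) \<Gamma> C (TensL f) (TensL f')"
| cong_tensR: "\<lbrakk>ceq S \<Gamma> A f f'; ceq None \<Delta> B g g'\<rbrakk>
    \<Longrightarrow> ceq S (\<Gamma> @ \<Delta>) (Tens A B) (TensR f g) (TensR f' g')"
| ax_Unit: "ceq (Some Unit) [] Unit (Ax Unit) (IL IR)"
| ax_Tens: "ceq (Some (Tens A B)) [] (Tens A B)
    (Ax (Tens A B)) (TensL (TensR (Ax A) (Pass (Ax B))))"
| ax_Lolli: "ceq (Some (Lolli A B)) [] (Lolli A B)
    (Ax (Lolli A B)) (LolliR (LolliL (Pass (Ax A)) (Ax B)))"
| tensR_pass: "\<lbrakk>derives f (Some A') \<Gamma> A; derives g None \<Delta> B\<rbrakk>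
    \<Longrightarrow> ceq None (A' # \<Gamma> @ \<Delta>) (Tens A B) (TensR (Pass f) g) (Pass (TensR f g))"
| tensR_IL: "\<lbrakk>derives f None \<Gamma> A; derives g None \<Delta> B\<rbrakk>
    \<Longrightarrow> ceq (Some Unit) (\<Gamma> @ \<Delta>) (Tens A B) (TensR (IL f) g) (IL (TensR f g))"
| tensR_tensL: "\<lbrakk>derives f (Some A') (B' # \<Gamma>) A; derives g None \<Delta> B\<rbrakk>
    \<Longrightarrow> ceq (Some (Tens A' B')) (\<Gamma> @ \<Delta>) (Tens A B) (TensR (TensL f) g) (TensL (TensR f g))"
| tensR_lolliL: "\<lbrakk>derives f None \<Gamma> A'; derives g (Some B') \<Delta> A; derives h None \<Lambda> B\<rbrakk>
    \<Longrightarrow> ceq (Some (Lolli A' B')) (\<Gamma> @ \<Delta> @ \<Lambda>) (Tens A B)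
          (TensR (LolliL f g) h) (LolliL f (TensR g h))"
| pass_lolliR: "derives f (Some A') (\<Gamma> @ [A]) B
    \<Longrightarrow> ceq None (A' # \<Gamma>) (Lolli A B) (Pass (LolliR f)) (LolliR (Pass f))"
| IL_lolliR: "derives f None (\<Gamma> @ [A]) B
    \<Longrightarrow> ceq (Some Unit) \<Gamma> (Lolli A B) (IL (LolliR f)) (LolliR (IL f))"
| tensL_lolliR: "derives f (Some A') (B' # \<Gamma> @ [A]) B
    \<Longrightarrow> ceq (Some (Tens A' B')) \<Gamma> (Lolli A B) (TensL (LolliR f)) (LolliR (TensL f))"
| lolliL_lolliR: "\<lbrakk>derives f None \<Gamma> A'; derives g (Some B') (\<Delta> @ [A]) B\<rbrakk>
    \<Longrightarrow> ceq (Some (Lolli A' B')) (\<Gamma> @ \<Delta>) (Lolli A B)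
          (LolliL f (LolliR g)) (LolliR (LolliL f g))"

text \<open>The union of the family; sequents being determined by derivations, it is a disjoint union.\<close>

definition ceq_rel :: "('x deriv \<times> 'x deriv) set" where
  "ceq_rel = {(f, g). \<exists>S \<Gamma> C. ceq S \<Gamma> C f g}"


section \<open>Cut\<close>

text \<open>Length of the context of the sequent of a (well-typed) derivation.\<close>

primrec ctx_len :: "'x deriv \<Rightarrow> nat" where
  "ctx_len (Ax A) = 0"
| "ctx_len (Pass f) = Suc (ctx_len f)"
| "ctx_len (LolliL f g) = ctx_len f + ctx_len g"
| "ctx_len (LolliR f) = ctx_len f - 1"
| "ctx_len (IL f) = ctx_len f"
| "ctx_len (TensL f) = ctx_len f - 1"
| "ctx_len IR = 0"
| "ctx_len (TensR f g) = ctx_len f + ctx_len g"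

text \<open>
  In \<open>ccut n f g\<close> the cut formula is the one at position \<open>n\<close> of the context of \<open>g\<close>, i.e. \<open>n\<close> is the
  length of \<open>\<Delta>\<^sub>0\<close>.  The values \<open>scut _ f g = f\<close> in the last equation of \<open>scut\<close> and
  \<open>ccut n f (Ax A) = ccut n f IR = f\<close> are dummies: no well-typed cut has these shapes.  In the
  principal case for \<open>-\<circ>\<close> the cut formula of the inner cut is the last one in the context of \<open>f\<close>.
\<close>

function (sequential)
  scut :: "'x deriv \<Rightarrow> 'x deriv \<Rightarrow> 'x deriv" and
  ccut :: "nat \<Rightarrow> 'x deriv \<Rightarrow> 'x deriv \<Rightarrow> 'x deriv" where
  "scut (Ax A) g = g"
| "scut (Pass f) g = Pass (scut f g)"
| "scut (IL f) g = IL (scut f g)"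
| "scut (TensL f) g = TensL (scut f g)"
| "scut (LolliL f f') g = LolliL f (scut f' g)"
| "scut f (Ax A) = f"
| "scut f (TensR g1 g2) = TensR (scut f g1) g2"
| "scut f (LolliR g) = LolliR (scut f g)"
| "scut IR (IL g) = g"
| "scut (TensR f1 f2) (TensL g) = scut f1 (ccut 0 f2 g)"
| "scut (LolliR f) (LolliL g1 g2) = scut (ccut (ctx_len f - 1) g1 f) g2"
| "scut f g = f"
| "ccut n f (Pass g) = (if n = 0 then scut f g else Pass (ccut (n - 1) f g))"
| "ccut n f (LolliL g1 g2) =
     (if n < ctx_len g1 then LolliL (ccut n f g1) g2 else LolliL g1 (ccut (n - ctx_len g1) f g2))"
| "ccut n f (LolliR g) = LolliR (ccut n f g)"
| "ccut n f (IL g) = IL (ccut n f g)"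
| "ccut n f (TensL g) = TensL (ccut (Suc n) f g)"
| "ccut n f (TensR g1 g2) =
     (if n < ctx_len g1 then TensR (ccut n f g1) g2 else TensR g1 (ccut (n - ctx_len g1) f g2))"
| "ccut n f (Ax A) = f"
| "ccut n f IR = f"
  by pat_completeness auto

lemma cut_size:
  "scut_ccut_dom (Inl (f, g)) \<Longrightarrow> size (scut f g) \<le> size f + size g"
  "scut_ccut_dom (Inr (n, f, g)) \<Longrightarrow> size (ccut n f g) \<le> size f + size g"
  by (induction f g and n f g rule: scut_ccut.pinduct)
    (auto simp: scut.psimps ccut.psimps)

termination
  by (relation "measure (\<lambda>x. case x of Inl (f, g) \<Rightarrow> size f + size g
                                     | Inr (n, f, g) \<Rightarrow> size f + size g)")
    (auto dest: cut_size)


section \<open>The category of formulae and derivations\<close>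

text \<open>
  Operations on derivations are transported to equivalence classes by taking unions of the classes
  of the results, as in theory \<open>Equiv_Relations\<close>.  Formulae over \<open>At\<close> are those whose atoms lie in \<open>At\<close>.  As
  derivations are cut-free, a derivation of a sequent of formulae over \<open>At\<close> only involves formulae
  over \<open>At\<close>.
\<close>

definition cls :: "'x deriv \<Rightarrow> 'x deriv set" where
  "cls f = ceq_rel `` {f}"

definition lift1 :: "('x deriv \<Rightarrow> 'x deriv) \<Rightarrow> 'x deriv set \<Rightarrow> 'x deriv set" where
  "lift1 h X = (\<Union>f\<in>X. cls (h f))"

definition lift2 ::
    "('x deriv \<Rightarrow> 'x deriv \<Rightarrow> 'x deriv) \<Rightarrow> 'x deriv set \<Rightarrow> 'x deriv set \<Rightarrow> 'x deriv set" where
  "lift2 h X Y = (\<Union>f\<in>X. \<Union>g\<in>Y. cls (h f g))"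

definition FSkMCl :: "'x set \<Rightarrow> ('x fma, 'x deriv set) skmc" where
  "FSkMCl At = \<lparr>
     Obj = {A. set_fma A \<subseteq> At},
     Hom = (\<lambda>A B. {f. derives f (Some A) [] B} // ceq_rel),
     Id = (\<lambda>A. cls (Ax A)),
     Comp = lift2 (\<lambda>g f. scut f g),
     UnitO = Unit,
     TensO = Tens,
     TensM = lift2 (\<lambda>f g. TensL (TensR f (Pass g))),
     LolliO = Lolli,
     LolliM = lift2 (\<lambda>f g. LolliR (LolliL (Pass f) g)),
     Curry = (\<lambda>A B C. lift1 (\<lambda>f. LolliR (scut (TensR (Ax A) (Pass (Ax B))) f))),
     Uncurry = (\<lambda>A B C. lift1 (\<lambda>g. TensL (scut g (LolliL (Pass (Ax B)) (Ax C))))),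
     Lam = (\<lambda>A. cls (TensL (IL (Pass (Ax A))))),
     Rho = (\<lambda>A. cls (TensR (Ax A) IR)),
     Alpha = (\<lambda>A B C. cls (TensL (TensL (TensR (Ax A) (Pass (TensR (Ax B) (Pass (Ax C))))))))\<rparr>"

end

theory Submission
  imports Defs
begin

text \<open>
  A sequent \<open>S | A\<^sub>1, \<dots>, A\<^sub>n \<turnstile> B\<close> is read as the hom-set from \<open>(\<dots>(S \<otimes> A\<^sub>1) \<otimes> \<dots>) \<otimes> A\<^sub>n\<close> to \<open>B\<close>, the
  empty stoup being the unit.  Writing \<open>T\<^sub>\<Gamma>\<close> for iterated right tensoring with \<open>\<Gamma>\<close>, the two-premise
  rules are interpreted by means of the natural map \<open>\<psi> : T\<^sub>\<Gamma> X \<rightarrow> X \<otimes> T\<^sub>\<Gamma> I\<close> built from \<open>\<rho>\<close> and \<open>\<alpha>\<close>.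
  The five axioms enter only through the compatibility of \<open>\<psi>\<close> with \<open>\<lambda>\<close>, \<open>\<alpha>\<close> and concatenation of
  contexts.  These laws make the interpretation invariant under \<open>ceq\<close> and turn \<open>scut\<close> into composition
  with \<open>T\<^sub>\<Delta> f\<close> and \<open>ccut\<close> into composition with \<open>T\<^sub>\<Lambda>\<close> of the map \<open>T\<^sub>\<Gamma> X \<rightarrow> X \<otimes> A\<close> that \<open>\<psi>\<close> yields from \<open>f\<close>.
\<close>

section \<open>Iterated tensoring in a skew monoidal category\<close>

text \<open>
  Arrows carry their source and target, so that the typing premises of the categorical laws become
  equations between objects, which the simplifier can decide.
\<close>

datatype ('o, 'm) arr = Arr (src: 'o) (raw: 'm) (tgt: 'o)

section \<open>Composition of typed arrows\<close>

context category
begin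

definition arrow :: "('o, 'm) arr \<Rightarrow> bool" where
  "arrow f \<longleftrightarrow> src f \<in> Obj C \<and> tgt f \<in> Obj C \<and> raw f \<in> Hom C (src f) (tgt f)"

definition ident :: "'o \<Rightarrow> ('o, 'm) arr" where
  "ident A = Arr A (Id C A) A"

definition comp :: "('o, 'm) arr \<Rightarrow> ('o, 'm) arr \<Rightarrow> ('o, 'm) arr"  (infixr "\<bullet>" 60) where
  "g \<bullet> f = Arr (src f) (raw g \<cdot> raw f) (tgt g)"

lemma src_tgt [simp]:
  "src (ident A) = A" "tgt (ident A) = A" "src (g \<bullet> f) = src f" "tgt (g \<bullet> f) = tgt g"
  by (simp_all add: ident_def comp_def)

lemma arrow_obj [simp]: "arrow f \<Longrightarrow> src f \<in> Obj C" "arrow f \<Longrightarrow> tgt f \<in> Obj C"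
  by (simp_all add: arrow_def)

lemma arrow_ident [simp]: "A \<in> Obj C \<Longrightarrow> arrow (ident A)"
  unfolding arrow_def by (simp add: ident_def id_hom)

lemma arrow_comp [simp]: "\<lbrakk>arrow f; arrow g; tgt f = src g\<rbrakk> \<Longrightarrow> arrow (g \<bullet> f)"
  unfolding arrow_def by (simp add: comp_def comp_hom[of "src f" "src g" "tgt g"])

lemma ident_comp [simp]: "\<lbrakk>arrow f; tgt f = A\<rbrakk> \<Longrightarrow> ident A \<bullet> f = f"
  unfolding arrow_def by (cases f) (auto simp: comp_def ident_def comp_id_left)

lemma comp_ident [simp]: "\<lbrakk>arrow f; src f = A\<rbrakk> \<Longrightarrow> f \<bullet> ident A = f"
  unfolding arrow_def by (cases f) (auto simp: comp_def ident_def comp_id_right)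

lemma assoc: "\<lbrakk>arrow f; arrow g; arrow h; tgt f = src g; tgt g = src h\<rbrakk>
    \<Longrightarrow> (h \<bullet> g) \<bullet> f = h \<bullet> g \<bullet> f"
  unfolding arrow_def comp_def by (simp add: comp_assoc[of "src f" "src g" "src h" "tgt h"])

text \<open>Composites are kept nested to the right, where an equation between two-fold composites
  no longer matches a subterm; this form applies it at the head of a longer chain.\<close>

lemma comp_eq_extend: "\<lbrakk>h \<bullet> g = h' \<bullet> g'; arrow f; arrow g; arrow h; arrow g'; arrow h';
      tgt f = src g; tgt g = src h; tgt g' = src h'\<rbrakk>
    \<Longrightarrow> h \<bullet> g \<bullet> f = h' \<bullet> g' \<bullet> f"
  by (metis assoc src_tgt(3))

lemma comp_eq_extend1: "\<lbrakk>h \<bullet> g = k; arrow f; arrow g; arrow h; tgt f = src g; tgt g = src h\<rbrakk>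
    \<Longrightarrow> h \<bullet> g \<bullet> f = k \<bullet> f"
  by (metis assoc)

end

section \<open>The skew monoidal structure in terms of arrows\<close>

context skew_monoidal_category
begin

definition tens :: "('a, 'b) arr \<Rightarrow> ('a, 'b) arr \<Rightarrow> ('a, 'b) arr"  (infixr "\<star>" 70) where
  "f \<star> g = Arr (src f \<otimes> src g) (raw f \<otimes>\<^sub>m raw g) (tgt f \<otimes> tgt g)"

definition lam :: "'a \<Rightarrow> ('a, 'b) arr" where
  "lam A = Arr (\<one> \<otimes> A) (Lam C A) A"

definition rho :: "'a \<Rightarrow> ('a, 'b) arr" where
  "rho A = Arr A (Rho C A) (A \<otimes> \<one>)"

definition alpha :: "'a \<Rightarrow> 'a \<Rightarrow> 'a \<Rightarrow> ('a, 'b) arr" where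
  "alpha A B D = Arr ((A \<otimes> B) \<otimes> D) (Alpha C A B D) (A \<otimes> (B \<otimes> D))"

lemmas objs [simp] = unit_obj tens_obj

lemma src_tgt_structural [simp]:
  "src (f \<star> g) = src f \<otimes> src g" "tgt (f \<star> g) = tgt f \<otimes> tgt g"
  "src (lam A) = \<one> \<otimes> A" "tgt (lam A) = A" "src (rho A) = A" "tgt (rho A) = A \<otimes> \<one>"
  "src (alpha A B D) = (A \<otimes> B) \<otimes> D" "tgt (alpha A B D) = A \<otimes> (B \<otimes> D)"
  by (simp_all add: tens_def lam_def rho_def alpha_def)

lemma arrow_structural [simp]:
  "\<lbrakk>arrow f; arrow g\<rbrakk> \<Longrightarrow> arrow (f \<star> g)"
  "A \<in> Obj C \<Longrightarrow> arrow (lam A)"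
  "A \<in> Obj C \<Longrightarrow> arrow (rho A)"
  "\<lbrakk>A \<in> Obj C; B \<in> Obj C; D \<in> Obj C\<rbrakk> \<Longrightarrow> arrow (alpha A B D)"
  unfolding arrow_def by (simp_all add: tens_def lam_def rho_def alpha_def tens_hom lam_hom rho_hom alpha_hom)

lemma tens_ident [simp]: "\<lbrakk>A \<in> Obj C; B \<in> Obj C\<rbrakk> \<Longrightarrow> ident A \<star> ident B = ident (A \<otimes> B)"
  by (simp add: tens_def ident_def tens_id)

lemma interchange: "\<lbrakk>arrow f; arrow f'; arrow g; arrow g'; tgt f = src f'; tgt g = src g'\<rbrakk>
    \<Longrightarrow> (f' \<star> g') \<bullet> (f \<star> g) = (f' \<bullet> f) \<star> (g' \<bullet> g)"
  unfolding arrow_def comp_def tens_def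
  by (simp add: tens_comp[of "src f" "src f'" "tgt f'" "src g" "src g'" "tgt g'"])

lemma lam_nat: "arrow f \<Longrightarrow> lam (tgt f) \<bullet> (ident \<one> \<star> f) = f \<bullet> lam (src f)"
  unfolding arrow_def by (simp add: comp_def tens_def lam_def ident_def lam_natural)

lemma rho_nat: "arrow f \<Longrightarrow> rho (tgt f) \<bullet> f = (f \<star> ident \<one>) \<bullet> rho (src f)"
  unfolding arrow_def by (simp add: comp_def tens_def rho_def ident_def rho_natural)

lemma alpha_nat: "\<lbrakk>arrow f; arrow g; arrow h\<rbrakk> \<Longrightarrow>
    alpha (tgt f) (tgt g) (tgt h) \<bullet> ((f \<star> g) \<star> h) = (f \<star> g \<star> h) \<bullet> alpha (src f) (src g) (src h)"
  unfolding arrow_def by (simp add: comp_def tens_def alpha_def alpha_natural)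

lemma lam_rho_unit: "lam \<one> \<bullet> rho \<one> = ident \<one>"
  by (simp add: comp_def lam_def rho_def ident_def lam_rho)

lemma triangle: "\<lbrakk>A \<in> Obj C; B \<in> Obj C\<rbrakk>
    \<Longrightarrow> (ident A \<star> lam B) \<bullet> alpha A \<one> B \<bullet> (rho A \<star> ident B) = ident (A \<otimes> B)"
  by (simp add: comp_def tens_def lam_def rho_def alpha_def ident_def lam_alpha_rho)

lemma lam_tens: "\<lbrakk>A \<in> Obj C; B \<in> Obj C\<rbrakk> \<Longrightarrow> lam (A \<otimes> B) \<bullet> alpha \<one> A B = lam A \<star> ident B"
  by (simp add: comp_def tens_def lam_def alpha_def ident_def lam_alpha)

lemma rho_tens: "\<lbrakk>A \<in> Obj C; B \<in> Obj C\<rbrakk> \<Longrightarrow> alpha A B \<one> \<bullet> rho (A \<otimes> B) = ident A \<star> rho B"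
  by (simp add: comp_def tens_def rho_def alpha_def ident_def alpha_rho)

lemma pentagon_arr: "\<lbrakk>A \<in> Obj C; B \<in> Obj C; D \<in> Obj C; E \<in> Obj C\<rbrakk>
    \<Longrightarrow> (ident A \<star> alpha B D E) \<bullet> alpha A (B \<otimes> D) E \<bullet> (alpha A B D \<star> ident E)
      = alpha A B (D \<otimes> E) \<bullet> alpha (A \<otimes> B) D E"
  by (simp add: comp_def tens_def alpha_def ident_def pentagon)

lemma tens_comp_ident:
  "\<lbrakk>arrow f; arrow g; tgt f = src g; B \<in> Obj C\<rbrakk> \<Longrightarrow> (g \<bullet> f) \<star> ident B = (g \<star> ident B) \<bullet> (f \<star> ident B)"
  by (simp add: interchange)

lemma ident_tens_comp:
  "\<lbrakk>arrow f; arrow g; tgt f = src g; B \<in> Obj C\<rbrakk> \<Longrightarrow> ident B \<star> (g \<bullet> f) = (ident B \<star> g) \<bullet> (ident B \<star> f)"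
  by (simp add: interchange)

section \<open>Iterated tensoring on the right by a context\<close>

text \<open>As a left fold, the action of \<open>\<Gamma> @ \<Delta>\<close> unfolds by
  simplification to that of \<Delta> after that of \<Gamma>.\<close>

abbreviation act :: "'a list \<Rightarrow> 'a \<Rightarrow> 'a" where
  "act \<Gamma> X \<equiv> foldl (\<otimes>) X \<Gamma>"

abbreviation actm :: "'a list \<Rightarrow> ('a, 'b) arr \<Rightarrow> ('a, 'b) arr" where
  "actm \<Gamma> f \<equiv> foldl (\<lambda>f A. f \<star> ident A) f \<Gamma>"

lemma act_obj [simp]: "\<lbrakk>X \<in> Obj C; set \<Gamma> \<subseteq> Obj C\<rbrakk> \<Longrightarrow> act \<Gamma> X \<in> Obj C"
  by (induction \<Gamma> arbitrary: X) auto

lemma src_tgt_actm [simp]: "src (actm \<Gamma> f) = act \<Gamma> (src f)" "tgt (actm \<Gamma> f) = act \<Gamma> (tgt f)"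
  by (induction \<Gamma> arbitrary: f) auto

lemma arrow_actm [simp]: "\<lbrakk>arrow f; set \<Gamma> \<subseteq> Obj C\<rbrakk> \<Longrightarrow> arrow (actm \<Gamma> f)"
  by (induction \<Gamma> arbitrary: f) auto

lemma actm_ident [simp]: "\<lbrakk>X \<in> Obj C; set \<Gamma> \<subseteq> Obj C\<rbrakk> \<Longrightarrow> actm \<Gamma> (ident X) = ident (act \<Gamma> X)"
  by (induction \<Gamma> arbitrary: X) auto

lemma actm_comp: "\<lbrakk>arrow f; arrow g; tgt f = src g; set \<Gamma> \<subseteq> Obj C\<rbrakk>
    \<Longrightarrow> actm \<Gamma> (g \<bullet> f) = actm \<Gamma> g \<bullet> actm \<Gamma> f"
  by (induction \<Gamma> arbitrary: f g) (auto simp: tens_comp_ident)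

section \<open>The iterated associator\<close>

text \<open>Moves a context from \<open>X \<otimes> Y\<close> onto the second factor. Each formula
  is absorbed by one \<open>alpha\<close>, taken under the action of the formulae after it.\<close>

primrec strength :: "'a \<Rightarrow> 'a \<Rightarrow> 'a list \<Rightarrow> ('a, 'b) arr" where
  "strength X Y [] = ident (X \<otimes> Y)"
| "strength X Y (A # \<Gamma>) = strength X (Y \<otimes> A) \<Gamma> \<bullet> actm \<Gamma> (alpha X Y A)"

lemma src_tgt_strength [simp]:
  "src (strength X Y \<Gamma>) = act \<Gamma> (X \<otimes> Y)" "tgt (strength X Y \<Gamma>) = X \<otimes> act \<Gamma> Y"
  by (induction \<Gamma> arbitrary: Y) auto

lemma arrow_strength [simp]:
  "\<lbrakk>X \<in> Obj C; Y \<in> Obj C; set \<Gamma> \<subseteq> Obj C\<rbrakk> \<Longrightarrow> arrow (strength X Y \<Gamma>)"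
  by (induction \<Gamma> arbitrary: Y) auto

text \<open>Iterates \<open>alpha_nat\<close> with an identity in the third place. The map
  \<open>g\<close> is generalised because it grows to \<open>g \<star> ident A\<close> along the
  context.\<close>

lemma strength_natural: "\<lbrakk>arrow f; arrow g; set \<Gamma> \<subseteq> Obj C\<rbrakk> \<Longrightarrow>
    strength (tgt f) (tgt g) \<Gamma> \<bullet> actm \<Gamma> (f \<star> g) = (f \<star> actm \<Gamma> g) \<bullet> strength (src f) (src g) \<Gamma>"
proof (induction \<Gamma> arbitrary: g)
  case (Cons A \<Gamma>)
  have "strength (tgt f) (tgt g) (A # \<Gamma>) \<bullet> actm (A # \<Gamma>) (f \<star> g)
      = strength (tgt f) (tgt g \<otimes> A) \<Gamma> \<bullet> actm \<Gamma> (alpha (tgt f) (tgt g) A \<bullet> ((f \<star> g) \<star> ident A))"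
    using Cons.prems by (simp add: assoc actm_comp)
  also have "\<dots> = strength (tgt f) (tgt g \<otimes> A) \<Gamma> \<bullet> actm \<Gamma> (f \<star> g \<star> ident A)
      \<bullet> actm \<Gamma> (alpha (src f) (src g) A)"
    using Cons.prems alpha_nat[of f g "ident A"] by (simp add: actm_comp)
  also have "\<dots> = (f \<star> actm (A # \<Gamma>) g) \<bullet> strength (src f) (src g) (A # \<Gamma>)"
    using Cons.prems comp_eq_extend[OF Cons.IH[of "g \<star> ident A"], of "actm \<Gamma> (alpha (src f) (src g) A)"]
    by simp
  finally show ?case .
qed auto

lemma strength_append: "\<lbrakk>X \<in> Obj C; Y \<in> Obj C; set \<Gamma> \<subseteq> Obj C; set \<Delta> \<subseteq> Obj C\<rbrakk> \<Longrightarrow>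
    strength X Y (\<Gamma> @ \<Delta>) = strength X (act \<Gamma> Y) \<Delta> \<bullet> actm \<Delta> (strength X Y \<Gamma>)"
  by (induction \<Gamma> arbitrary: Y) (auto simp: actm_comp assoc)

text \<open>The pentagon iterated along a context, one use of \<open>pentagon_arr\<close> for each
  formula; \<open>Z\<close> is generalised since it absorbs the formulae one by one.\<close>

lemma strength_assoc: "\<lbrakk>X \<in> Obj C; Y \<in> Obj C; Z \<in> Obj C; set \<Gamma> \<subseteq> Obj C\<rbrakk> \<Longrightarrow>
    (ident X \<star> strength Y Z \<Gamma>) \<bullet> strength X (Y \<otimes> Z) \<Gamma> \<bullet> actm \<Gamma> (alpha X Y Z)
      = alpha X Y (act \<Gamma> Z) \<bullet> strength (X \<otimes> Y) Z \<Gamma>"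
proof (induction \<Gamma> arbitrary: Z)
  case (Cons A \<Gamma>)
  have "(ident X \<star> strength Y Z (A # \<Gamma>)) \<bullet> strength X (Y \<otimes> Z) (A # \<Gamma>) \<bullet> actm (A # \<Gamma>) (alpha X Y Z)
      = (ident X \<star> strength Y (Z \<otimes> A) \<Gamma>)
        \<bullet> (ident X \<star> actm \<Gamma> (alpha Y Z A)) \<bullet> strength X ((Y \<otimes> Z) \<otimes> A) \<Gamma>
        \<bullet> actm \<Gamma> (alpha X (Y \<otimes> Z) A) \<bullet> actm \<Gamma> (alpha X Y Z \<star> ident A)"
    using Cons.prems by (simp add: ident_tens_comp assoc)
  \<comment> \<open>\<open>strength_natural\<close> moves \<open>alpha Y Z A\<close> to the right of
    \<open>strength\<close>, so that the three associators forming one side of the pentagon stand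
    together under a single \<open>actm\<close>.\<close>
  also have "\<dots> = (ident X \<star> strength Y (Z \<otimes> A) \<Gamma>) \<bullet> strength X (Y \<otimes> (Z \<otimes> A)) \<Gamma>
        \<bullet> actm \<Gamma> ((ident X \<star> alpha Y Z A) \<bullet> alpha X (Y \<otimes> Z) A \<bullet> (alpha X Y Z \<star> ident A))"
    using Cons.prems comp_eq_extend[OF strength_natural[of "ident X" "alpha Y Z A" \<Gamma>],
        of "actm \<Gamma> (alpha X (Y \<otimes> Z) A \<bullet> (alpha X Y Z \<star> ident A))"]
    by (simp add: actm_comp)
  also have "\<dots> = ((ident X \<star> strength Y (Z \<otimes> A) \<Gamma>) \<bullet> strength X (Y \<otimes> (Z \<otimes> A)) \<Gamma>
        \<bullet> actm \<Gamma> (alpha X Y (Z \<otimes> A))) \<bullet> actm \<Gamma> (alpha (X \<otimes> Y) Z A)"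
    using Cons.prems by (simp add: pentagon_arr actm_comp assoc)
  also have "\<dots> = alpha X Y (act (A # \<Gamma>) Z) \<bullet> strength (X \<otimes> Y) Z (A # \<Gamma>)"
    using Cons.prems by (subst Cons.IH) (simp_all add: assoc)
  finally show ?case .
qed simp

text \<open>Each \<open>alpha\<close> inside \<open>strength\<close> is absorbed by
  \<open>lam\<close> through \<open>lam_tens\<close>.\<close>

lemma strength_lam: "\<lbrakk>Y \<in> Obj C; set \<Gamma> \<subseteq> Obj C\<rbrakk> \<Longrightarrow>
    lam (act \<Gamma> Y) \<bullet> strength \<one> Y \<Gamma> = actm \<Gamma> (lam Y)"
proof (induction \<Gamma> arbitrary: Y)
  case (Cons A \<Gamma>)
  have "lam (act (A # \<Gamma>) Y) \<bullet> strength \<one> Y (A # \<Gamma>)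
      = (lam (act \<Gamma> (Y \<otimes> A)) \<bullet> strength \<one> (Y \<otimes> A) \<Gamma>) \<bullet> actm \<Gamma> (alpha \<one> Y A)"
    using Cons.prems by (simp add: assoc)
  also have "\<dots> = actm \<Gamma> (lam (Y \<otimes> A) \<bullet> alpha \<one> Y A)"
    using Cons by (simp add: actm_comp)
  finally show ?case
    using Cons.prems by (simp add: lam_tens)
qed simp

section \<open>The comparison map \<open>psi\<close> and its coherence laws\<close>

definition psi :: "'a \<Rightarrow> 'a list \<Rightarrow> ('a, 'b) arr" where
  "psi X \<Gamma> = strength X \<one> \<Gamma> \<bullet> actm \<Gamma> (rho X)"

lemma src_tgt_psi [simp]: "src (psi X \<Gamma>) = act \<Gamma> X" "tgt (psi X \<Gamma>) = X \<otimes> act \<Gamma> \<one>"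
  by (simp_all add: psi_def)

lemma arrow_psi [simp]: "\<lbrakk>X \<in> Obj C; set \<Gamma> \<subseteq> Obj C\<rbrakk> \<Longrightarrow> arrow (psi X \<Gamma>)"
  by (simp add: psi_def)

lemma psi_Nil [simp]: "X \<in> Obj C \<Longrightarrow> psi X [] = rho X"
  by (simp add: psi_def)

lemma psi_natural: "\<lbrakk>arrow f; set \<Gamma> \<subseteq> Obj C\<rbrakk> \<Longrightarrow>
    psi (tgt f) \<Gamma> \<bullet> actm \<Gamma> f = (f \<star> ident (act \<Gamma> \<one>)) \<bullet> psi (src f) \<Gamma>"
  using comp_eq_extend[OF strength_natural[of f "ident \<one>" \<Gamma>], of "actm \<Gamma> (rho (src f))"]
  by (simp add: psi_def assoc actm_comp[symmetric] rho_nat)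

lemma psi_append: "\<lbrakk>X \<in> Obj C; set \<Gamma> \<subseteq> Obj C; set \<Delta> \<subseteq> Obj C\<rbrakk> \<Longrightarrow>
    psi X (\<Gamma> @ \<Delta>) = strength X (act \<Gamma> \<one>) \<Delta> \<bullet> actm \<Delta> (psi X \<Gamma>)"
  by (simp add: psi_def strength_append actm_comp assoc)

text \<open>By \<open>triangle\<close>, the unit that \<open>rho\<close> inserts inside
  \<open>psi\<close> is cancelled by the \<open>lam\<close> on the first formula. This evaluates
  \<open>TensR\<close> against a right premise ending in \<open>Pass\<close>, whose denotation
  begins with that \<open>lam\<close>.\<close>

lemma psi_Cons_lam: "\<lbrakk>X \<in> Obj C; A \<in> Obj C; set \<Gamma> \<subseteq> Obj C\<rbrakk> \<Longrightarrow>
    (ident X \<star> actm \<Gamma> (lam A)) \<bullet> psi X (A # \<Gamma>) = strength X A \<Gamma>"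
proof -
  assume *: "X \<in> Obj C" "A \<in> Obj C" "set \<Gamma> \<subseteq> Obj C"
  have "(ident X \<star> actm \<Gamma> (lam A)) \<bullet> psi X (A # \<Gamma>)
      = (ident X \<star> actm \<Gamma> (lam A)) \<bullet> strength X (\<one> \<otimes> A) \<Gamma>
        \<bullet> actm \<Gamma> (alpha X \<one> A) \<bullet> actm \<Gamma> (rho X \<star> ident A)"
    using * by (simp add: psi_def assoc)
  also have "\<dots> = strength X A \<Gamma>
        \<bullet> actm \<Gamma> ((ident X \<star> lam A) \<bullet> alpha X \<one> A \<bullet> (rho X \<star> ident A))"
    using * comp_eq_extend[OF strength_natural[of "ident X" "lam A" \<Gamma>],
        of "actm \<Gamma> (alpha X \<one> A \<bullet> (rho X \<star> ident A))"]
    by (simp add: actm_comp)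
  finally show ?thesis
    using * by (simp add: triangle)
qed

lemma psi_singleton_lam: "\<lbrakk>X \<in> Obj C; A \<in> Obj C\<rbrakk> \<Longrightarrow> (ident X \<star> lam A) \<bullet> psi X [A] = ident (X \<otimes> A)"
  using psi_Cons_lam[of X A "[]"] by simp

text \<open>\<open>rho_tens\<close> turns the unit inserted beside \<open>X \<otimes> Y\<close> into
  one inserted beside \<open>Y\<close> alone; \<open>strength_assoc\<close> carries the context past
  the associator.\<close>

lemma psi_tens: "\<lbrakk>X \<in> Obj C; Y \<in> Obj C; set \<Gamma> \<subseteq> Obj C\<rbrakk> \<Longrightarrow>
    alpha X Y (act \<Gamma> \<one>) \<bullet> psi (X \<otimes> Y) \<Gamma> = (ident X \<star> psi Y \<Gamma>) \<bullet> strength X Y \<Gamma>"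
proof -
  assume *: "X \<in> Obj C" "Y \<in> Obj C" "set \<Gamma> \<subseteq> Obj C"
  have "alpha X Y (act \<Gamma> \<one>) \<bullet> psi (X \<otimes> Y) \<Gamma>
      = (alpha X Y (act \<Gamma> \<one>) \<bullet> strength (X \<otimes> Y) \<one> \<Gamma>) \<bullet> actm \<Gamma> (rho (X \<otimes> Y))"
    using * by (simp add: psi_def assoc)
  also have "\<dots> = (ident X \<star> strength Y \<one> \<Gamma>) \<bullet> strength X (Y \<otimes> \<one>) \<Gamma>
        \<bullet> actm \<Gamma> (alpha X Y \<one> \<bullet> rho (X \<otimes> Y))"
    using * by (simp add: strength_assoc[symmetric] assoc actm_comp)
  also have "\<dots> = (ident X \<star> psi Y \<Gamma>) \<bullet> strength X Y \<Gamma>"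
    using * strength_natural[of "ident X" "rho Y" \<Gamma>]
    by (simp add: rho_tens psi_def ident_tens_comp assoc)
  finally show ?thesis .
qed

text \<open>\<open>strength_lam\<close> moves \<open>lam\<close> to the innermost unit, where
  \<open>lam_rho_unit\<close> cancels it against the \<open>rho\<close> of
  \<open>psi\<close>.\<close>

lemma psi_lam: "set \<Gamma> \<subseteq> Obj C \<Longrightarrow> lam (act \<Gamma> \<one>) \<bullet> psi \<one> \<Gamma> = ident (act \<Gamma> \<one>)"
  by (simp add: psi_def comp_eq_extend1[OF strength_lam] actm_comp[symmetric] lam_rho_unit)

section \<open>Replacing a stretch of context by the formula derived from it\<close>

text \<open>If \<open>m\<close> interprets a derivation with empty stoup and context \<Gamma>, this
  map replaces a copy of \<Gamma> to the right of \<open>X\<close> by \<open>tgt m\<close>. Both a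
  cut into a context and the rule \<open>LolliL\<close> need it.\<close>

definition plug :: "'a \<Rightarrow> 'a list \<Rightarrow> ('a, 'b) arr \<Rightarrow> ('a, 'b) arr" where
  "plug X \<Gamma> m = (ident X \<star> m) \<bullet> psi X \<Gamma>"

lemma src_tgt_plug [simp]: "src (plug X \<Gamma> m) = act \<Gamma> X" "tgt (plug X \<Gamma> m) = X \<otimes> tgt m"
  by (simp_all add: plug_def)

lemma arrow_plug [simp]:
  "\<lbrakk>X \<in> Obj C; set \<Gamma> \<subseteq> Obj C; arrow m; src m = act \<Gamma> \<one>\<rbrakk> \<Longrightarrow> arrow (plug X \<Gamma> m)"
  by (simp add: plug_def)

text \<open>Rewrites the denotation of \<open>TensR\<close> as \<open>f\<close> carried out under
  its context, followed by plugging \<open>m\<close>; this is the form that a cut against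
  \<open>TensL\<close> produces.\<close>

lemma tens_psi: "\<lbrakk>arrow f; arrow m; set \<Gamma> \<subseteq> Obj C; src m = act \<Gamma> \<one>\<rbrakk> \<Longrightarrow>
    (f \<star> m) \<bullet> psi (src f) \<Gamma> = plug (tgt f) \<Gamma> m \<bullet> actm \<Gamma> f"
  by (simp add: plug_def assoc psi_natural) (simp add: comp_eq_extend1[OF interchange])

lemma plug_natural: "\<lbrakk>arrow f; arrow m; set \<Gamma> \<subseteq> Obj C; src m = act \<Gamma> \<one>\<rbrakk> \<Longrightarrow>
    plug (tgt f) \<Gamma> m \<bullet> actm \<Gamma> f = (f \<star> ident (tgt m)) \<bullet> plug (src f) \<Gamma> m"
  by (subst tens_psi[symmetric]) (simp_all add: plug_def comp_eq_extend1[OF interchange])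

text \<open>A map \<open>f\<close> precomposed to the left premise of \<open>TensR\<close> can leave
  it, by \<open>psi_natural\<close>. This handles left rules and cuts in that premise.\<close>

lemma tens_psi_comp:
  assumes "arrow f" "arrow g" "tgt f = src g" "arrow k" "src k = act \<Gamma> \<one>" "set \<Gamma> \<subseteq> Obj C"
  shows "((g \<bullet> f) \<star> k) \<bullet> psi (src f) \<Gamma> = (g \<star> k) \<bullet> psi (tgt f) \<Gamma> \<bullet> actm \<Gamma> f"
proof -
  have "(g \<star> k) \<bullet> psi (tgt f) \<Gamma> \<bullet> actm \<Gamma> f = (g \<star> k) \<bullet> (f \<star> ident (act \<Gamma> \<one>)) \<bullet> psi (src f) \<Gamma>"
    using assms psi_natural[of f \<Gamma>] by simp
  also have "\<dots> = ((g \<bullet> f) \<star> k) \<bullet> psi (src f) \<Gamma>"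
    using assms by (simp add: comp_eq_extend1[OF interchange])
  finally show ?thesis ..
qed

lemma plug_comp: "\<lbrakk>X \<in> Obj C; arrow m; arrow k; tgt m = src k; set \<Gamma> \<subseteq> Obj C; src m = act \<Gamma> \<one>\<rbrakk> \<Longrightarrow>
    plug X \<Gamma> (k \<bullet> m) = (ident X \<star> k) \<bullet> plug X \<Gamma> m"
  by (simp add: plug_def ident_tens_comp assoc)

text \<open>The \<open>lam\<close> introduced by \<open>Pass\<close> cancels the unit that
  \<open>psi\<close> inserts, so plugging a passivated map is plain tensoring.\<close>

lemma plug_singleton_lam:
  assumes "X \<in> Obj C" "arrow m"
  shows "plug X [src m] (m \<bullet> lam (src m)) = ident X \<star> m"
  using assms by (simp add: plug_comp) (simp add: plug_def psi_singleton_lam)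

text \<open>The formula \<open>tgt m\<close> enters the second factor through one
  \<open>alpha\<close>. Sliding that \<open>alpha\<close> past \<open>m\<close> leaves it composed
  with \<open>psi\<close>, which \<open>psi_tens\<close> evaluates.\<close>

lemma strength_plug:
  assumes "X \<in> Obj C" "Y \<in> Obj C" "set \<Gamma> \<subseteq> Obj C" "set \<Delta> \<subseteq> Obj C" "arrow m" "src m = act \<Gamma> \<one>"
  shows "strength X Y (tgt m # \<Delta>) \<bullet> actm \<Delta> (plug (X \<otimes> Y) \<Gamma> m)
    = (ident X \<star> actm \<Delta> (plug Y \<Gamma> m)) \<bullet> strength X Y (\<Gamma> @ \<Delta>)"
proof -
  \<comment> \<open>This is in essence the case of empty \<Delta>; naturality of
    \<open>strength\<close> adds the formulae of \<Delta> afterwards.\<close>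
  have "alpha X Y (tgt m) \<bullet> plug (X \<otimes> Y) \<Gamma> m
      = (ident X \<star> ident Y \<star> m) \<bullet> alpha X Y (act \<Gamma> \<one>) \<bullet> psi (X \<otimes> Y) \<Gamma>"
    using assms comp_eq_extend[OF alpha_nat[of "ident X" "ident Y" m], of "psi (X \<otimes> Y) \<Gamma>"]
    by (simp add: plug_def)
  also have "\<dots> = (ident X \<star> plug Y \<Gamma> m) \<bullet> strength X Y \<Gamma>"
    using assms by (simp add: psi_tens plug_def ident_tens_comp assoc)
  finally have *: "alpha X Y (tgt m) \<bullet> plug (X \<otimes> Y) \<Gamma> m = (ident X \<star> plug Y \<Gamma> m) \<bullet> strength X Y \<Gamma>" .
  have "strength X Y (tgt m # \<Delta>) \<bullet> actm \<Delta> (plug (X \<otimes> Y) \<Gamma> m)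
      = strength X (Y \<otimes> tgt m) \<Delta> \<bullet> actm \<Delta> (alpha X Y (tgt m) \<bullet> plug (X \<otimes> Y) \<Gamma> m)"
    using assms by (simp add: actm_comp assoc)
  also have "\<dots> = (ident X \<star> actm \<Delta> (plug Y \<Gamma> m)) \<bullet> strength X Y (\<Gamma> @ \<Delta>)"
    unfolding * using assms comp_eq_extend[OF strength_natural[of "ident X" "plug Y \<Gamma> m" \<Delta>],
        of "actm \<Delta> (strength X Y \<Gamma>)"]
    by (simp add: actm_comp strength_append)
  finally show ?thesis .
qed

text \<open>By naturality \<open>lam\<close> passes \<open>m\<close> and then cancels
  \<open>psi\<close>. This settles the cut at the passivated formula, where \<open>ccut\<close>
  becomes \<open>scut\<close>.\<close>

lemma lam_plug:
  assumes "arrow m" "src m = act \<Gamma> \<one>" "set \<Gamma> \<subseteq> Obj C"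
  shows "lam (tgt m) \<bullet> plug \<one> \<Gamma> m = m"
  using assms comp_eq_extend[OF lam_nat[of m], of "psi \<one> \<Gamma>"] by (simp add: plug_def psi_lam)

text \<open>Splitting \<open>psi\<close> after \<Delta> exposes \<open>psi X \<Delta>\<close>, which
  \<open>plug_natural\<close> moves out of the way of \<open>strength_plug\<close>. It serves cuts
  whose formula lies in a context that \<open>psi\<close> gathers.\<close>

lemma psi_plug:
  assumes "X \<in> Obj C" "set \<Gamma> \<subseteq> Obj C" "set \<Delta> \<subseteq> Obj C" "set \<Lambda> \<subseteq> Obj C" "arrow m" "src m = act \<Gamma> \<one>"
  shows "psi X (\<Delta> @ tgt m # \<Lambda>) \<bullet> actm \<Lambda> (plug (act \<Delta> X) \<Gamma> m)
    = (ident X \<star> actm \<Lambda> (plug (act \<Delta> \<one>) \<Gamma> m)) \<bullet> psi X (\<Delta> @ \<Gamma> @ \<Lambda>)"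
proof -
  let ?Y = "act \<Delta> \<one>"
  have "psi X (\<Delta> @ tgt m # \<Lambda>) \<bullet> actm \<Lambda> (plug (act \<Delta> X) \<Gamma> m)
      = strength X ?Y (tgt m # \<Lambda>) \<bullet> actm \<Lambda> ((psi X \<Delta> \<star> ident (tgt m)) \<bullet> plug (act \<Delta> X) \<Gamma> m)"
    using assms by (simp add: psi_append assoc actm_comp del: strength.simps)
  also have "\<dots> = strength X ?Y (tgt m # \<Lambda>) \<bullet> actm \<Lambda> (plug (X \<otimes> ?Y) \<Gamma> m) \<bullet> actm (\<Gamma> @ \<Lambda>) (psi X \<Delta>)"
    using assms plug_natural[of "psi X \<Delta>" m \<Gamma>, symmetric]
    by (simp add: actm_comp del: strength.simps)
  also have "\<dots> = (ident X \<star> actm \<Lambda> (plug ?Y \<Gamma> m)) \<bullet> strength X ?Y (\<Gamma> @ \<Lambda>) \<bullet> actm (\<Gamma> @ \<Lambda>) (psi X \<Delta>)"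
    using assms by (intro comp_eq_extend[OF strength_plug]) simp_all
  also have "\<dots> = (ident X \<star> actm \<Lambda> (plug ?Y \<Gamma> m)) \<bullet> psi X (\<Delta> @ \<Gamma> @ \<Lambda>)"
    using assms by (simp add: psi_append)
  finally show ?thesis .
qed

text \<open>Serves \<open>ccut\<close> twice: at the right premise of \<open>TensR\<close> and, with
  an identity for \<open>j\<close>, at the left premise of \<open>LolliL\<close>.\<close>

lemma tens_psi_plug:
  assumes "arrow j" "arrow k" "src k = act (\<Delta> @ tgt m # \<Lambda>) \<one>" "arrow m" "src m = act \<Gamma> \<one>"
    "set \<Gamma> \<subseteq> Obj C" "set \<Delta> \<subseteq> Obj C" "set \<Lambda> \<subseteq> Obj C"
  shows "(j \<star> k) \<bullet> psi (src j) (\<Delta> @ tgt m # \<Lambda>) \<bullet> actm \<Lambda> (plug (act \<Delta> (src j)) \<Gamma> m)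
    = (j \<star> (k \<bullet> actm \<Lambda> (plug (act \<Delta> \<one>) \<Gamma> m))) \<bullet> psi (src j) (\<Delta> @ \<Gamma> @ \<Lambda>)"
proof -
  have "(j \<star> k) \<bullet> psi (src j) (\<Delta> @ tgt m # \<Lambda>) \<bullet> actm \<Lambda> (plug (act \<Delta> (src j)) \<Gamma> m)
      = (j \<star> k) \<bullet> (ident (src j) \<star> actm \<Lambda> (plug (act \<Delta> \<one>) \<Gamma> m)) \<bullet> psi (src j) (\<Delta> @ \<Gamma> @ \<Lambda>)"
    using assms by (simp add: psi_plug)
  also have "\<dots> = (j \<star> (k \<bullet> actm \<Lambda> (plug (act \<Delta> \<one>) \<Gamma> m))) \<bullet> psi (src j) (\<Delta> @ \<Gamma> @ \<Lambda>)"
    using assms by (simp add: comp_eq_extend1[OF interchange])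
  finally show ?thesis .
qed

end


section \<open>Evaluation and transposition\<close>

context skew_monoidal_closed_category
begin

text \<open>The factors are arguments because the object \<open>A \<otimes> B\<close> need not
  determine them.\<close>

definition curry_arr :: "'a \<Rightarrow> 'a \<Rightarrow> ('a, 'b) arr \<Rightarrow> ('a, 'b) arr" where
  "curry_arr A B f = Arr A (Curry C A B (tgt f) (raw f)) (B -\<circ> tgt f)"

definition eval_arr :: "'a \<Rightarrow> 'a \<Rightarrow> ('a, 'b) arr" where
  "eval_arr B D = Arr ((B -\<circ> D) \<otimes> B) (Uncurry C (B -\<circ> D) B D (Id C (B -\<circ> D))) D"

definition lolli_arr :: "('a, 'b) arr \<Rightarrow> ('a, 'b) arr \<Rightarrow> ('a, 'b) arr" where
  "lolli_arr b d = Arr (tgt b -\<circ> src d) (raw b -\<circ>\<^sub>m raw d) (src b -\<circ> tgt d)"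

lemmas [simp] = lolli_obj

lemma src_tgt_closed [simp]:
  "src (curry_arr A B f) = A" "tgt (curry_arr A B f) = B -\<circ> tgt f"
  "src (eval_arr B D) = (B -\<circ> D) \<otimes> B" "tgt (eval_arr B D) = D"
  "src (lolli_arr b d) = tgt b -\<circ> src d" "tgt (lolli_arr b d) = src b -\<circ> tgt d"
  by (simp_all add: curry_arr_def eval_arr_def lolli_arr_def)

lemma arrow_curry [simp]:
  "\<lbrakk>arrow f; src f = A \<otimes> B; A \<in> Obj C; B \<in> Obj C\<rbrakk> \<Longrightarrow> arrow (curry_arr A B f)"
  unfolding arrow_def by (simp add: curry_arr_def curry_hom)

lemma arrow_eval [simp]: "\<lbrakk>B \<in> Obj C; D \<in> Obj C\<rbrakk> \<Longrightarrow> arrow (eval_arr B D)"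
  unfolding arrow_def by (simp add: eval_arr_def uncurry_hom id_hom)

lemma arrow_lolli [simp]: "\<lbrakk>arrow b; arrow d\<rbrakk> \<Longrightarrow> arrow (lolli_arr b d)"
  unfolding arrow_def by (simp add: lolli_arr_def lolli_hom)

lemma curry_nat:
  assumes "arrow f" "src f = A \<otimes> B" "A \<in> Obj C" "arrow a" "tgt a = A" "arrow b" "tgt b = B"
    "arrow d" "src d = tgt f"
  shows "curry_arr (src a) (src b) (d \<bullet> f \<bullet> (a \<star> b)) = lolli_arr b d \<bullet> curry_arr A B f \<bullet> a"
  using assms curry_natural[of A "src a" B "src b" "tgt f" "tgt d" "raw a" "raw b" "raw d" "raw f"]
  unfolding arrow_def by (auto simp: curry_arr_def comp_def tens_def lolli_arr_def)

lemma lolli_ident: "\<lbrakk>A \<in> Obj C; B \<in> Obj C\<rbrakk> \<Longrightarrow> lolli_arr (ident A) (ident B) = ident (A -\<circ> B)"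
  by (simp add: lolli_arr_def ident_def lolli_id)

lemma curry_comp:
  assumes "arrow f" "src f = A \<otimes> B" "A \<in> Obj C" "B \<in> Obj C" "arrow a" "tgt a = A"
  shows "curry_arr A B f \<bullet> a = curry_arr (src a) B (f \<bullet> (a \<star> ident B))"
  using curry_nat[of f A B a "ident B" "ident (tgt f)"] assms by (simp add: lolli_ident)

lemma curry_eval [simp]: "\<lbrakk>B \<in> Obj C; D \<in> Obj C\<rbrakk> \<Longrightarrow> curry_arr (B -\<circ> D) B (eval_arr B D) = ident (B -\<circ> D)"
  by (simp add: curry_arr_def eval_arr_def ident_def curry_uncurry id_hom)

lemma curry_inject: "\<lbrakk>curry_arr A B f = curry_arr A B g; arrow f; arrow g; src f = A \<otimes> B; src g = A \<otimes> B;
      tgt f = tgt g; A \<in> Obj C; B \<in> Obj C\<rbrakk> \<Longrightarrow> f = g"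
  unfolding arrow_def by (cases f; cases g) (simp add: curry_arr_def, metis uncurry_curry)

text \<open>Both sides have the same transpose: \<open>curry_comp\<close> extracts
  \<open>curry_arr A B f\<close>, and the transpose of evaluation is an identity. Transposition is
  injective.\<close>

lemma eval_curry:
  assumes "arrow f" "src f = A \<otimes> B" "A \<in> Obj C" "B \<in> Obj C"
  shows "eval_arr B (tgt f) \<bullet> (curry_arr A B f \<star> ident B) = f"
proof (rule curry_inject[of A B])
  show "curry_arr A B (eval_arr B (tgt f) \<bullet> (curry_arr A B f \<star> ident B)) = curry_arr A B f"
    using assms by (subst curry_comp[symmetric, of "eval_arr B (tgt f)" "B -\<circ> tgt f" B "curry_arr A B f", simplified]) simp_all
qed (use assms in simp_all)

text \<open>The beta law with an argument that uses up a context; it matches the principal cut of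
  \<open>LolliR\<close> against \<open>LolliL\<close>.\<close>

lemma eval_plug_curry:
  assumes "arrow f" "src f = A \<otimes> B" "A \<in> Obj C" "B \<in> Obj C"
    "arrow m" "src m = act \<Gamma> \<one>" "tgt m = B" "set \<Gamma> \<subseteq> Obj C"
  shows "eval_arr B (tgt f) \<bullet> plug (B -\<circ> tgt f) \<Gamma> m \<bullet> actm \<Gamma> (curry_arr A B f) = f \<bullet> plug A \<Gamma> m"
  using assms plug_natural[of "curry_arr A B f" m \<Gamma>]
    comp_eq_extend1[OF eval_curry[of f A B], of "plug A \<Gamma> m"] by simp

text \<open>Naturality of transposition at the evaluation map, whose transpose is the
  identity.\<close>

lemma curry_lolli:
  assumes "arrow b" "arrow d"
  shows "curry_arr (tgt b -\<circ> src d) (src b) (d \<bullet> eval_arr (tgt b) (src d) \<bullet> (ident (tgt b -\<circ> src d) \<star> b)) = lolli_arr b d"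
  using assms curry_nat[of "eval_arr (tgt b) (src d)" "tgt b -\<circ> src d" "tgt b" "ident (tgt b -\<circ> src d)" b d]
  by simp

end

section \<open>Interpretation of derivations\<close>

text \<open>With \<open>split_append_right\<close>, locates the cut formula in one premise of a
  two-premise rule.\<close>

lemma split_append_left:
  assumes "\<Gamma> @ \<Gamma>' = \<Delta> @ A # \<Lambda>" "length \<Delta> < length \<Gamma>"
  obtains \<Lambda>' where "\<Gamma> = \<Delta> @ A # \<Lambda>'" "\<Lambda> = \<Lambda>' @ \<Gamma>'"
  using assms by (auto simp: append_eq_append_conv2 append_eq_Cons_conv)

lemma split_append_right:
  assumes "\<Gamma> @ \<Gamma>' = \<Delta> @ A # \<Lambda>" "\<not> length \<Delta> < length \<Gamma>"
  obtains \<Delta>' where "\<Delta> = \<Gamma> @ \<Delta>'" "\<Gamma>' = \<Delta>' @ A # \<Lambda>"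
  using assms by (auto simp: append_eq_append_conv2 append_eq_Cons_conv)

section \<open>Denotations of formulae and derivations\<close>

locale fma_interpretation = skew_monoidal_closed_category +
  fixes v :: "'x \<Rightarrow> 'a"
  assumes v_obj [simp]: "v x \<in> Obj C"
begin

primrec ob :: "'x fma \<Rightarrow> 'a" where
  "ob (Atom x) = v x"
| "ob Unit = \<one>"
| "ob (Tens A B) = ob A \<otimes> ob B"
| "ob (Lolli A B) = ob A -\<circ> ob B"

lemma ob_obj [simp]: "ob A \<in> Obj C"
  by (induction A) auto

lemma ob_image [simp]: "ob ` X \<subseteq> Obj C"
  by auto

primrec stoup_ob :: "'x fma option \<Rightarrow> 'a" where
  "stoup_ob None = \<one>"
| "stoup_ob (Some A) = ob A"

lemma stoup_ob_obj [simp]: "stoup_ob S \<in> Obj C"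
  by (cases S) auto

abbreviation obs :: "'x fma list \<Rightarrow> 'a list" where
  "obs \<equiv> map ob"

text \<open>A relation, because the arrows mention stoups, contexts and formulae that raw terms do
  not carry. \<open>IL\<close> and \<open>TensL\<close> keep the arrow, premise and conclusion
  having the same source object. \<open>LolliL\<close> plugs the argument beside the implication and
  evaluates, all under \<Delta>.\<close>

inductive denotes ::
    "'x deriv \<Rightarrow> 'x fma option \<Rightarrow> 'x fma list \<Rightarrow> 'x fma \<Rightarrow> ('a, 'b) arr \<Rightarrow> bool" where
  ax: "denotes (Ax A) (Some A) [] A (ident (ob A))"
| pass: "denotes f (Some A) \<Gamma> E m
    \<Longrightarrow> denotes (Pass f) None (A # \<Gamma>) E (m \<bullet> actm (obs \<Gamma>) (lam (ob A)))"
| lolliL: "\<lbrakk>denotes f None \<Gamma> A m; denotes g (Some B) \<Delta> E k\<rbrakk>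
    \<Longrightarrow> denotes (LolliL f g) (Some (Lolli A B)) (\<Gamma> @ \<Delta>) E
          (k \<bullet> actm (obs \<Delta>) (eval_arr (ob A) (ob B) \<bullet> plug (ob A -\<circ> ob B) (obs \<Gamma>) m))"
| lolliR: "denotes f S (\<Gamma> @ [A]) B m
    \<Longrightarrow> denotes (LolliR f) S \<Gamma> (Lolli A B) (curry_arr (act (obs \<Gamma>) (stoup_ob S)) (ob A) m)"
| IL: "denotes f None \<Gamma> E m \<Longrightarrow> denotes (IL f) (Some Unit) \<Gamma> E m"
| tensL: "denotes f (Some A) (B # \<Gamma>) E m \<Longrightarrow> denotes (TensL f) (Some (Tens A B)) \<Gamma> E m"
| IR: "denotes IR None [] Unit (ident \<one>)"
| tensR: "\<lbrakk>denotes f S \<Gamma> A m; denotes g None \<Delta> B k\<rbrakk>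
    \<Longrightarrow> denotes (TensR f g) S (\<Gamma> @ \<Delta>) (Tens A B)
          ((m \<star> k) \<bullet> psi (act (obs \<Gamma>) (stoup_ob S)) (obs \<Delta>))"

inductive_cases denotes_AxE: "denotes (Ax A) S \<Gamma> E m"
inductive_cases denotes_PassE: "denotes (Pass f) S \<Gamma> E m"
inductive_cases denotes_LolliLE: "denotes (LolliL f g) S \<Gamma> E m"
inductive_cases denotes_LolliRE: "denotes (LolliR f) S \<Gamma> E m"
inductive_cases denotes_ILE: "denotes (IL f) S \<Gamma> E m"
inductive_cases denotes_TensLE: "denotes (TensL f) S \<Gamma> E m"
inductive_cases denotes_IRE: "denotes IR S \<Gamma> E m"
inductive_cases denotes_TensRE: "denotes (TensR f g) S \<Gamma> E m"

lemmas denotes_elims = denotes_AxE denotes_PassE denotes_LolliLE denotes_LolliRE denotes_ILE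
  denotes_TensLE denotes_IRE denotes_TensRE

lemma denotes_arrow:
  assumes "denotes f S \<Gamma> E m"
  shows "arrow m" "src m = act (obs \<Gamma>) (stoup_ob S)" "tgt m = ob E"
  using assms by (induction) simp_all

text \<open>Axioms carry their formula, so a raw term fixes its sequent together with its
  arrow.\<close>

lemma denotes_unique:
  assumes "denotes f S \<Gamma> E m" "denotes f S' \<Gamma>' E' m'"
  shows "S = S' \<and> \<Gamma> = \<Gamma>' \<and> E = E' \<and> m = m'"
  using assms by (induction arbitrary: S' \<Gamma>' E' m') (erule denotes_elims, fastforce)+

lemma denotes_derives: "denotes f S \<Gamma> E m \<Longrightarrow> derives f S \<Gamma> E"
  by (induction rule: denotes.induct) (auto intro: derives.intros)

lemma derives_denotes: "derives f S \<Gamma> E \<Longrightarrow> \<exists>m. denotes f S \<Gamma> E m"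
  by (induction rule: derives.induct) (blast intro: denotes.intros)+

lemma ctx_len_denotes: "denotes f S \<Gamma> E m \<Longrightarrow> ctx_len f = length \<Gamma>"
  by (induction rule: denotes.induct) auto

section \<open>Cut as composition\<close>

text \<open>In the principal cases for tensor and implication the outer cut takes the result of the
  inner one as an argument; this bound keeps it within an induction on total size.\<close>

lemma size_scut: "size (scut f g) \<le> size f + size g"
  and size_ccut: "size (ccut n f g) \<le> size f + size g"
  by (induction f g and n f g rule: scut_ccut.induct) auto

lemma scut_right:
  assumes "f = IR \<or> (\<exists>f1 f2. f = TensR f1 f2) \<or> (\<exists>f'. f = LolliR f')"
  shows "scut f (Ax A) = f" "scut f (TensR g1 g2) = TensR (scut f g1) g2"
    "scut f (LolliR g) = LolliR (scut f g)"
  using assms by auto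

text \<open>When \<open>f\<close> ends with a right rule, \<open>scut\<close> is decided by the last
  rule of \<open>g\<close>. The induction hypotheses appear as assumptions so that the induction
  step for cut can be split over several lemmas.\<close>

lemma denotes_cut_right:
  assumes f: "denotes f S \<Gamma> A m" "f = IR \<or> (\<exists>f1 f2. f = TensR f1 f2) \<or> (\<exists>f'. f = LolliR f')"
    and g: "denotes g (Some A) \<Delta> E k"
    and scut_IH: "\<And>f' g' S \<Gamma> A \<Delta> E m k. \<lbrakk>size f' + size g' < size f + size g;
        denotes f' S \<Gamma> A m; denotes g' (Some A) \<Delta> E k\<rbrakk>
      \<Longrightarrow> denotes (scut f' g') S (\<Gamma> @ \<Delta>) E (k \<bullet> actm (obs \<Delta>) m)"
    and ccut_IH: "\<And>f' g' S \<Gamma> A \<Delta> \<Lambda> E m k. \<lbrakk>size f' + size g' < size f + size g;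
        denotes f' None \<Gamma> A m; denotes g' S (\<Delta> @ A # \<Lambda>) E k\<rbrakk>
      \<Longrightarrow> denotes (ccut (length \<Delta>) f' g') S (\<Delta> @ \<Gamma> @ \<Lambda>) E
            (k \<bullet> actm (obs \<Lambda>) (plug (act (obs \<Delta>) (stoup_ob S)) (obs \<Gamma>) m))"
  shows "denotes (scut f g) S (\<Gamma> @ \<Delta>) E (k \<bullet> actm (obs \<Delta>) m)"
proof -
  note m = denotes_arrow[OF f(1)]
  show ?thesis
    using g
  proof (cases rule: denotes.cases)
    case ax
    then show ?thesis
      using f m by (simp add: scut_right)
  next
    case (lolliL g1 \<Delta>1 A1 k1 g2 B \<Delta>2 k2)
    with f obtain f' m' where f': "f = LolliR f'" "denotes f' S (\<Gamma> @ [A1]) B m'"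
        "m = curry_arr (act (obs \<Gamma>) (stoup_ob S)) (ob A1) m'"
      by (auto elim: denotes_elims)
    note arrs = denotes_arrow[OF f'(2)] denotes_arrow[OF lolliL(5)] denotes_arrow[OF lolliL(6)]
    \<comment> \<open>The inner cut formula is the last one of \<open>\<Gamma> @ [A1]\<close>:
      nothing follows it, and its position \<open>ctx_len f' - 1\<close> is
      \<open>length \<Gamma>\<close>.\<close>
    have "denotes (ccut (length \<Gamma>) g1 f') S (\<Gamma> @ \<Delta>1 @ []) B
        (m' \<bullet> actm (obs []) (plug (act (obs \<Gamma>) (stoup_ob S)) (obs \<Delta>1) k1))"
      using f' lolliL by (intro ccut_IH) simp_all
    moreover have "size (ccut (length \<Gamma>) g1 f') + size g2 < size f + size g"
      using size_ccut[of "length \<Gamma>" g1 f'] by (simp add: f' lolliL)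
    ultimately have "denotes (scut (ccut (length \<Gamma>) g1 f') g2) S ((\<Gamma> @ \<Delta>1) @ \<Delta>2) E
        (k2 \<bullet> actm (obs \<Delta>2) (m' \<bullet> plug (act (obs \<Gamma>) (stoup_ob S)) (obs \<Delta>1) k1))"
      using lolliL by (intro scut_IH) simp_all
    \<comment> \<open>Evaluating the transpose of \<open>m'\<close> at \<open>k1\<close> is
      \<open>m'\<close> after plugging \<open>k1\<close>, which is what the inner cut
      denotes.\<close>
    then show ?thesis
      using f' lolliL arrs ctx_len_denotes[OF f'(2)]
        eval_plug_curry[of m' "act (obs \<Gamma>) (stoup_ob S)" "ob A1" k1 "obs \<Delta>1"]
      by (simp add: actm_comp[symmetric] assoc)
  next
    case (lolliR g' A1 B k')
    have "denotes (scut f g') S ((\<Gamma> @ \<Delta>) @ [A1]) B (k' \<bullet> actm (obs (\<Delta> @ [A1])) m)"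
      unfolding append_assoc using f lolliR by (intro scut_IH) simp_all
    from denotes.lolliR[OF this] show ?thesis
      using f m lolliR denotes_arrow[OF lolliR(4)] by (simp add: scut_right curry_comp)
  next
    case (IL g')
    with f have "f = IR" "S = None" "\<Gamma> = []" "m = ident \<one>"
      by (auto elim: denotes_elims)
    with IL show ?thesis
      using denotes_arrow[OF IL(3)] by simp
  next
    case (tensL g' A1 A2)
    with f obtain f1 f2 \<Gamma>1 \<Gamma>2 m1 m2 where f': "f = TensR f1 f2" "\<Gamma> = \<Gamma>1 @ \<Gamma>2"
        "denotes f1 S \<Gamma>1 A1 m1" "denotes f2 None \<Gamma>2 A2 m2"
        "m = (m1 \<star> m2) \<bullet> psi (act (obs \<Gamma>1) (stoup_ob S)) (obs \<Gamma>2)"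
      by (auto elim: denotes_elims)
    note arrs = denotes_arrow[OF f'(3)] denotes_arrow[OF f'(4)] denotes_arrow[OF tensL(3)]
    \<comment> \<open>The cut formula \<open>A2\<close> heads the context of \<open>g'\<close>,
      hence position 0 with nothing before it.\<close>
    have "denotes (ccut 0 f2 g') (Some A1) (\<Gamma>2 @ \<Delta>) E (k \<bullet> actm (obs \<Delta>) (plug (ob A1) (obs \<Gamma>2) m2))"
      using f' tensL ccut_IH[of f2 g' \<Gamma>2 A2 m2 "Some A1" "[]" \<Delta> E k] by simp
    moreover have "size f1 + size (ccut 0 f2 g') < size f + size g"
      using size_ccut[of 0 f2 g'] by (simp add: f' tensL)
    ultimately have "denotes (scut f1 (ccut 0 f2 g')) S (\<Gamma>1 @ \<Gamma>2 @ \<Delta>) E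
        ((k \<bullet> actm (obs \<Delta>) (plug (ob A1) (obs \<Gamma>2) m2)) \<bullet> actm (obs (\<Gamma>2 @ \<Delta>)) m1)"
      using f' by (intro scut_IH) simp_all
    then show ?thesis
      using f' tensL arrs tens_psi[of m1 m2 "obs \<Gamma>2"] by (simp add: actm_comp[symmetric] assoc)
  next
    case (tensR g1 \<Delta>1 B1 k1 g2 \<Delta>2 B2 k2)
    have "denotes (scut f g1) S (\<Gamma> @ \<Delta>1) B1 (k1 \<bullet> actm (obs \<Delta>1) m)"
      using f tensR by (intro scut_IH) simp_all
    from denotes.tensR[OF this tensR(6)] show ?thesis
      using f m tensR denotes_arrow[OF tensR(5)] denotes_arrow[OF tensR(6)]
        tens_psi_comp[of "actm (obs \<Delta>1) m" k1 k2 "obs \<Delta>2"]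
      by (simp add: scut_right assoc)
  qed
qed

text \<open>A left rule precomposes a map to the arrow of a premise or keeps that arrow, so
  composing with \<open>k\<close> on the other side commutes with it by associativity and
  functoriality of \<open>actm\<close>.\<close>

lemma denotes_scut_step:
  assumes f: "denotes f S \<Gamma> A m" and g: "denotes g (Some A) \<Delta> E k"
    and scut_IH: "\<And>f' g' S \<Gamma> A \<Delta> E m k. \<lbrakk>size f' + size g' < size f + size g;
        denotes f' S \<Gamma> A m; denotes g' (Some A) \<Delta> E k\<rbrakk>
      \<Longrightarrow> denotes (scut f' g') S (\<Gamma> @ \<Delta>) E (k \<bullet> actm (obs \<Delta>) m)"
    and ccut_IH: "\<And>f' g' S \<Gamma> A \<Delta> \<Lambda> E m k. \<lbrakk>size f' + size g' < size f + size g;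
        denotes f' None \<Gamma> A m; denotes g' S (\<Delta> @ A # \<Lambda>) E k\<rbrakk>
      \<Longrightarrow> denotes (ccut (length \<Delta>) f' g') S (\<Delta> @ \<Gamma> @ \<Lambda>) E
            (k \<bullet> actm (obs \<Lambda>) (plug (act (obs \<Delta>) (stoup_ob S)) (obs \<Gamma>) m))"
  shows "denotes (scut f g) S (\<Gamma> @ \<Delta>) E (k \<bullet> actm (obs \<Delta>) m)"
proof -
  have right: ?thesis if "f = IR \<or> (\<exists>f1 f2. f = TensR f1 f2) \<or> (\<exists>f'. f = LolliR f')"
    by (rule denotes_cut_right[OF f that g]) (rule scut_IH ccut_IH; assumption)+
  note k = denotes_arrow[OF g]
  show ?thesis
    using f
  proof (cases rule: denotes.cases)
    case ax
    with g k show ?thesis by simp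
  next
    case (pass f' B \<Gamma>' m')
    have "denotes (scut f' g) (Some B) (\<Gamma>' @ \<Delta>) E (k \<bullet> actm (obs \<Delta>) m')"
      using g pass by (intro scut_IH) simp_all
    from denotes.pass[OF this] show ?thesis
      using k pass denotes_arrow[OF pass(5)] by (simp add: actm_comp assoc)
  next
    case (lolliL f1 \<Gamma>1 A1 m1 f2 B \<Gamma>2 m2)
    have "denotes (scut f2 g) (Some B) (\<Gamma>2 @ \<Delta>) E (k \<bullet> actm (obs \<Delta>) m2)"
      using g lolliL by (intro scut_IH) simp_all
    from denotes.lolliL[OF lolliL(5) this] show ?thesis
      using k lolliL denotes_arrow[OF lolliL(5)] denotes_arrow[OF lolliL(6)]
      by (simp add: actm_comp assoc)
  next
    case (IL f')
    have "denotes (scut f' g) None (\<Gamma> @ \<Delta>) E (k \<bullet> actm (obs \<Delta>) m)"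
      using g IL by (intro scut_IH) simp_all
    with IL show ?thesis by (simp add: denotes.IL)
  next
    case (tensL f' A1 A2)
    have "denotes (scut f' g) (Some A1) ((A2 # \<Gamma>) @ \<Delta>) E (k \<bullet> actm (obs \<Delta>) m)"
      using g tensL by (intro scut_IH) simp_all
    with tensL show ?thesis by (simp add: denotes.tensL)
  qed (use right in blast)+
qed

text \<open>The recursion is on \<open>g\<close>. Premises whose context is gathered by
  \<open>psi\<close> need \<open>tens_psi_plug\<close>; a map that a left rule puts in front passes
  the plugged one by \<open>plug_natural\<close>.\<close>

lemma denotes_ccut_step:
  assumes f: "denotes f None \<Gamma> A m" and g: "denotes g S (\<Delta> @ A # \<Lambda>) E k"
    and scut_IH: "\<And>f' g' S \<Gamma> A \<Delta> E m k. \<lbrakk>size f' + size g' < size f + size g;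
        denotes f' S \<Gamma> A m; denotes g' (Some A) \<Delta> E k\<rbrakk>
      \<Longrightarrow> denotes (scut f' g') S (\<Gamma> @ \<Delta>) E (k \<bullet> actm (obs \<Delta>) m)"
    and ccut_IH: "\<And>f' g' S \<Gamma> A \<Delta> \<Lambda> E m k. \<lbrakk>size f' + size g' < size f + size g;
        denotes f' None \<Gamma> A m; denotes g' S (\<Delta> @ A # \<Lambda>) E k\<rbrakk>
      \<Longrightarrow> denotes (ccut (length \<Delta>) f' g') S (\<Delta> @ \<Gamma> @ \<Lambda>) E
            (k \<bullet> actm (obs \<Lambda>) (plug (act (obs \<Delta>) (stoup_ob S)) (obs \<Gamma>) m))"
  shows "denotes (ccut (length \<Delta>) f g) S (\<Delta> @ \<Gamma> @ \<Lambda>) E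
    (k \<bullet> actm (obs \<Lambda>) (plug (act (obs \<Delta>) (stoup_ob S)) (obs \<Gamma>) m))"
proof -
  note m = denotes_arrow[OF f]
  have ccut_IH': "denotes (ccut n f g') S (\<Delta> @ \<Gamma> @ \<Lambda>) E
      (k \<bullet> actm (obs \<Lambda>) (plug (act (obs \<Delta>) (stoup_ob S)) (obs \<Gamma>) m))"
    if "denotes g' S (\<Delta> @ A # \<Lambda>) E k" "n = length \<Delta>" "size g' < size g" for g' S \<Delta> \<Lambda> E k n
    using ccut_IH[of f g' \<Gamma> A m S \<Delta> \<Lambda> E k] f that by simp
  show ?thesis
    using g
  proof (cases rule: denotes.cases)
    case ax
    then show ?thesis by simp
  next
    case (pass g' B \<Gamma>' k')
    note k' = denotes_arrow[OF pass(5)]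
    show ?thesis
    proof (cases \<Delta>)
      case Nil
      then have "denotes (scut f g') None (\<Gamma> @ \<Lambda>) E (k' \<bullet> actm (obs \<Lambda>) m)"
        using f pass by (intro scut_IH) simp_all
      \<comment> \<open>The \<open>lam\<close> contributed by \<open>Pass\<close> cancels the detour
        through \<open>plug\<close>, leaving the composite that \<open>scut\<close> denotes.\<close>
      moreover have "lam (ob A) \<bullet> plug \<one> (obs \<Gamma>) m = m"
        using m lam_plug[of m "obs \<Gamma>"] by simp
      ultimately show ?thesis
        using Nil pass m k' by (simp add: assoc actm_comp[symmetric])
    next
      case (Cons B' \<Delta>')
      with pass have \<Gamma>': "B' = B" "\<Gamma>' = \<Delta>' @ A # \<Lambda>" by auto
      then have "denotes (ccut (length \<Delta>') f g') (Some B) (\<Delta>' @ \<Gamma> @ \<Lambda>) E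
          (k' \<bullet> actm (obs \<Lambda>) (plug (act (obs \<Delta>') (stoup_ob (Some B))) (obs \<Gamma>) m))"
        using pass by (intro ccut_IH') simp_all
      from denotes.pass[OF this] show ?thesis
        using Cons \<Gamma>' pass(1,2,4,5) m k' plug_natural[of "actm (obs \<Delta>') (lam (ob B))" m "obs \<Gamma>"]
        by (simp add: assoc actm_comp[symmetric])
    qed
  next
    case (lolliL g1 \<Delta>1 A1 k1 g2 B \<Delta>2 k2)
    note arrs = denotes_arrow[OF lolliL(5)] denotes_arrow[OF lolliL(6)] ctx_len_denotes[OF lolliL(5)]
    show ?thesis
    proof (cases "length \<Delta> < length \<Delta>1")
      case True
      then obtain \<Lambda>' where \<Lambda>': "\<Delta>1 = \<Delta> @ A # \<Lambda>'" "\<Lambda> = \<Lambda>' @ \<Delta>2"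
        using lolliL split_append_left by metis
      then have "denotes (ccut (length \<Delta>) f g1) None (\<Delta> @ \<Gamma> @ \<Lambda>') A1
          (k1 \<bullet> actm (obs \<Lambda>') (plug (act (obs \<Delta>) (stoup_ob None)) (obs \<Gamma>) m))"
        using lolliL by (intro ccut_IH') simp_all
      \<comment> \<open>The context of the left premise is gathered beside the implication, so
        \<open>tens_psi_plug\<close> applies with an identity in the left factor.\<close>
      from denotes.lolliL[OF this lolliL(6)] show ?thesis
        using \<Lambda>' lolliL m arrs tens_psi_plug[of "ident (ob A1 -\<circ> ob B)" k1 "obs \<Delta>" m "obs \<Lambda>'" "obs \<Gamma>"]
        by (simp add: assoc actm_comp[symmetric] plug_def[of _ _ k1] plug_def[of _ _ "k1 \<bullet> _"])
    next
      case False
      then obtain \<Delta>' where \<Delta>': "\<Delta> = \<Delta>1 @ \<Delta>'" "\<Delta>2 = \<Delta>' @ A # \<Lambda>"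
        using lolliL split_append_right by metis
      then have "denotes (ccut (length \<Delta>') f g2) (Some B) (\<Delta>' @ \<Gamma> @ \<Lambda>) E
          (k2 \<bullet> actm (obs \<Lambda>) (plug (act (obs \<Delta>') (stoup_ob (Some B))) (obs \<Gamma>) m))"
        using lolliL by (intro ccut_IH') simp_all
      \<comment> \<open>The map contributed by \<open>LolliL\<close> acts to the left of the cut
        formula and so commutes with plugging.\<close>
      from denotes.lolliL[OF lolliL(5) this] show ?thesis
        using \<Delta>' lolliL m arrs
          plug_natural[of "actm (obs \<Delta>') (eval_arr (ob A1) (ob B) \<bullet> plug (ob A1 -\<circ> ob B) (obs \<Delta>1) k1)" m "obs \<Gamma>"]
        by (simp add: assoc actm_comp[symmetric])
    qed
  next
    case (lolliR g' A1 B k')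
    then have "denotes (ccut (length \<Delta>) f g') S (\<Delta> @ \<Gamma> @ \<Lambda> @ [A1]) B
        (k' \<bullet> actm (obs (\<Lambda> @ [A1])) (plug (act (obs \<Delta>) (stoup_ob S)) (obs \<Gamma>) m))"
      by (intro ccut_IH') simp_all
    then have "denotes (ccut (length \<Delta>) f g') S ((\<Delta> @ \<Gamma> @ \<Lambda>) @ [A1]) B
        (k' \<bullet> actm (obs (\<Lambda> @ [A1])) (plug (act (obs \<Delta>) (stoup_ob S)) (obs \<Gamma>) m))"
      by simp
    from denotes.lolliR[OF this] show ?thesis
      using lolliR m denotes_arrow[OF lolliR(4)] by (simp add: curry_comp)
  next
    case (IL g')
    then show ?thesis
      using ccut_IH'[OF IL(3)] by (simp add: denotes.IL)
  next
    case (tensL g' A1 A2)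
    then show ?thesis
      using ccut_IH'[of g' "Some A1" "A2 # \<Delta>" \<Lambda> E k] by (simp add: denotes.tensL)
  next
    case IR
    then show ?thesis by simp
  next
    case (tensR g1 \<Delta>1 B1 k1 g2 \<Delta>2 B2 k2)
    note arrs = denotes_arrow[OF tensR(5)] denotes_arrow[OF tensR(6)] ctx_len_denotes[OF tensR(5)]
    show ?thesis
    proof (cases "length \<Delta> < length \<Delta>1")
      case True
      then obtain \<Lambda>' where \<Lambda>': "\<Delta>1 = \<Delta> @ A # \<Lambda>'" "\<Lambda> = \<Lambda>' @ \<Delta>2"
        using tensR split_append_left by metis
      then have "denotes (ccut (length \<Delta>) f g1) S (\<Delta> @ \<Gamma> @ \<Lambda>') B1
          (k1 \<bullet> actm (obs \<Lambda>') (plug (act (obs \<Delta>) (stoup_ob S)) (obs \<Gamma>) m))"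
        using tensR by (intro ccut_IH') simp_all
      from denotes.tensR[OF this tensR(6)] show ?thesis
        using \<Lambda>' tensR m arrs
          tens_psi_comp[of "actm (obs \<Lambda>') (plug (act (obs \<Delta>) (stoup_ob S)) (obs \<Gamma>) m)" k1 k2 "obs \<Delta>2"]
        by (simp add: assoc)
    next
      case False
      then obtain \<Delta>' where \<Delta>': "\<Delta> = \<Delta>1 @ \<Delta>'" "\<Delta>2 = \<Delta>' @ A # \<Lambda>"
        using tensR split_append_right by metis
      then have "denotes (ccut (length \<Delta>') f g2) None (\<Delta>' @ \<Gamma> @ \<Lambda>) B2
          (k2 \<bullet> actm (obs \<Lambda>) (plug (act (obs \<Delta>') (stoup_ob None)) (obs \<Gamma>) m))"
        using tensR by (intro ccut_IH') simp_all
      from denotes.tensR[OF tensR(5) this] show ?thesis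
        using \<Delta>' tensR m arrs tens_psi_plug[of k1 k2 "obs \<Delta>'" m "obs \<Lambda>" "obs \<Gamma>"]
        by (simp add: assoc)
    qed
  qed
qed

text \<open>The two operations call each other, so one induction on total size proves both
  halves.\<close>

lemma denotes_cut:
  "(\<forall>S \<Gamma> A \<Delta> E m k. denotes f S \<Gamma> A m \<longrightarrow> denotes g (Some A) \<Delta> E k \<longrightarrow>
      denotes (scut f g) S (\<Gamma> @ \<Delta>) E (k \<bullet> actm (obs \<Delta>) m)) \<and>
   (\<forall>S \<Gamma> A \<Delta> \<Lambda> E m k. denotes f None \<Gamma> A m \<longrightarrow> denotes g S (\<Delta> @ A # \<Lambda>) E k \<longrightarrow>
      denotes (ccut (length \<Delta>) f g) S (\<Delta> @ \<Gamma> @ \<Lambda>) E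
        (k \<bullet> actm (obs \<Lambda>) (plug (act (obs \<Delta>) (stoup_ob S)) (obs \<Gamma>) m)))"
proof (induction "size f + size g" arbitrary: f g rule: less_induct)
  case less
  note scut_IH = less.hyps[THEN conjunct1, rule_format]
    and ccut_IH = less.hyps[THEN conjunct2, rule_format]
  show ?case
    by (intro conjI allI impI; rule denotes_scut_step denotes_ccut_step)
       (assumption | (rule scut_IH ccut_IH; assumption))+
qed

lemmas denotes_scut = denotes_cut[THEN conjunct1, rule_format]

section \<open>Invariance under \<open>ceq\<close>\<close>

text \<open>The \<open>lam\<close> of \<open>Pass\<close> cancels the unit inserted by
  \<open>psi\<close>. At identities this is the expansion law for axioms on tensors.\<close>

lemma denotes_tens:
  assumes f: "denotes f (Some A) [] A' m" and g: "denotes g (Some B) [] B' k"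
  shows "denotes (TensL (TensR f (Pass g))) (Some (Tens A B)) [] (Tens A' B') (m \<star> k)"
proof -
  note m = denotes_arrow[OF f] and k = denotes_arrow[OF g]
  have "denotes (TensR f (Pass g)) (Some A) [B] (Tens A' B') ((m \<star> (k \<bullet> lam (ob B))) \<bullet> psi (ob A) [ob B])"
    using denotes.tensR[OF f denotes.pass[OF g]] by simp
  moreover have "(m \<star> (k \<bullet> lam (ob B))) \<bullet> psi (ob A) [ob B] = m \<star> k"
    using m k tens_psi[of m "k \<bullet> lam (ob B)" "[ob B]"] plug_singleton_lam[of "ob A'" k]
      interchange[of m "ident (ob A')" "ident (ob B)" k]
    by simp
  ultimately show ?thesis
    by (simp add: denotes.tensL)
qed

text \<open>\<open>plug_singleton_lam\<close> reduces the passivated argument to tensoring with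
  \<open>m\<close>, and \<open>curry_lolli\<close> recognises the transpose. At identities this is
  the expansion law for axioms on implications.\<close>

lemma denotes_lolli:
  assumes f: "denotes f (Some A') [] A m" and g: "denotes g (Some B) [] B' k"
  shows "denotes (LolliR (LolliL (Pass f) g)) (Some (Lolli A B)) [] (Lolli A' B') (lolli_arr m k)"
proof -
  note m = denotes_arrow[OF f] and k = denotes_arrow[OF g]
  have "denotes (LolliL (Pass f) g) (Some (Lolli A B)) ([] @ [A']) B'
      (k \<bullet> eval_arr (ob A) (ob B) \<bullet> (ident (ob A -\<circ> ob B) \<star> m))"
    using denotes.lolliL[OF denotes.pass[OF f] g] m k plug_singleton_lam[of "ob A -\<circ> ob B" m] by simp
  from denotes.lolliR[OF this] show ?thesis
    using m k curry_lolli[of m k] by simp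
qed

text \<open>The expansion laws say that the connectives preserve identities. \<open>Pass\<close> and
  \<open>LolliL\<close> precompose a map, which leaves \<open>TensR\<close> by
  \<open>tens_psi_comp\<close> and \<open>LolliR\<close> by \<open>curry_comp\<close>;
  \<open>IL\<close> and \<open>TensL\<close> keep the arrow, so their permutations hold at
  once.\<close>

lemma ceq_denotes: "ceq S \<Gamma> E f g \<Longrightarrow> \<exists>m. denotes f S \<Gamma> E m \<and> denotes g S \<Gamma> E m"
proof (induction rule: ceq.induct)
  case (refl f S \<Gamma> E)
  then show ?case using derives_denotes by blast
next
  case (trans S \<Gamma> E f g h)
  \<comment> \<open>Both hypotheses give an arrow for \<open>g\<close>; uniqueness identifies the
    two.\<close>
  then show ?case using denotes_unique by blast
next
  case (ax_Tens A B)
  then show ?case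
    using denotes_tens[OF denotes.ax[of A] denotes.ax[of B]] denotes.ax[of "Tens A B"] by auto
next
  case (ax_Lolli A B)
  then show ?case
    using denotes_lolli[OF denotes.ax[of A] denotes.ax[of B]] denotes.ax[of "Lolli A B"]
    by (auto simp: lolli_ident)
next
  case (tensR_pass f A' \<Gamma> A g \<Delta> B)
  then obtain m k where mk: "denotes f (Some A') \<Gamma> A m" "denotes g None \<Delta> B k"
    using derives_denotes by metis
  have "denotes (TensR (Pass f) g) None ((A' # \<Gamma>) @ \<Delta>) (Tens A B)
    (((m \<bullet> actm (obs \<Gamma>) (lam (ob A'))) \<star> k) \<bullet> psi (act (obs (A' # \<Gamma>)) (stoup_ob None)) (obs \<Delta>))"
    by (intro denotes.intros mk)
  moreover have "denotes (Pass (TensR f g)) None (A' # \<Gamma> @ \<Delta>) (Tens A B)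
    (((m \<star> k) \<bullet> psi (act (obs \<Gamma>) (stoup_ob (Some A'))) (obs \<Delta>)) \<bullet> actm (obs (\<Gamma> @ \<Delta>)) (lam (ob A')))"
    by (intro denotes.intros mk)
  ultimately show ?case
    using denotes_arrow[OF mk(1)] denotes_arrow[OF mk(2)]
      tens_psi_comp[of "actm (obs \<Gamma>) (lam (ob A'))" m k "obs \<Delta>"]
    by (auto simp: assoc)
next
  case (tensR_lolliL f \<Gamma> A' g B' \<Delta> A h \<Lambda> B)
  then obtain l m k where lmk: "denotes f None \<Gamma> A' l" "denotes g (Some B') \<Delta> A m" "denotes h None \<Lambda> B k"
    using derives_denotes by metis
  let ?e = "eval_arr (ob A') (ob B') \<bullet> plug (ob A' -\<circ> ob B') (obs \<Gamma>) l"
  have "denotes (TensR (LolliL f g) h) (Some (Lolli A' B')) ((\<Gamma> @ \<Delta>) @ \<Lambda>) (Tens A B)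
    (((m \<bullet> actm (obs \<Delta>) ?e) \<star> k) \<bullet> psi (act (obs (\<Gamma> @ \<Delta>)) (stoup_ob (Some (Lolli A' B')))) (obs \<Lambda>))"
    by (intro denotes.intros lmk)
  moreover have "denotes (LolliL f (TensR g h)) (Some (Lolli A' B')) (\<Gamma> @ \<Delta> @ \<Lambda>) (Tens A B)
    (((m \<star> k) \<bullet> psi (act (obs \<Delta>) (stoup_ob (Some B'))) (obs \<Lambda>)) \<bullet> actm (obs (\<Delta> @ \<Lambda>)) ?e)"
    by (intro denotes.intros lmk)
  ultimately show ?case
    using denotes_arrow[OF lmk(1)] denotes_arrow[OF lmk(2)] denotes_arrow[OF lmk(3)]
      tens_psi_comp[of "actm (obs \<Delta>) ?e" m k "obs \<Lambda>"]
    by (auto simp: assoc)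
next
  case (pass_lolliR f A' \<Gamma> A B)
  then obtain m where m: "denotes f (Some A') (\<Gamma> @ [A]) B m"
    using derives_denotes by metis
  have "denotes (LolliR (Pass f)) None \<Gamma>' (Lolli A B)
      (curry_arr (act (obs \<Gamma>') (stoup_ob None)) (ob A) (m \<bullet> actm (obs (\<Gamma> @ [A])) (lam (ob A'))))"
    if "\<Gamma>' = A' # \<Gamma>" for \<Gamma>'
    using denotes.pass[OF m] that by (intro denotes.lolliR) simp
  with denotes.pass[OF denotes.lolliR[OF m]] show ?case
    using denotes_arrow[OF m] by (auto simp: curry_comp)
next
  case (lolliL_lolliR f \<Gamma> A' g B' \<Delta> A B)
  then obtain l m where lm: "denotes f None \<Gamma> A' l" "denotes g (Some B') (\<Delta> @ [A]) B m"
    using derives_denotes by metis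
  let ?e = "eval_arr (ob A') (ob B') \<bullet> plug (ob A' -\<circ> ob B') (obs \<Gamma>) l"
  have "denotes (LolliR (LolliL f g)) (Some (Lolli A' B')) (\<Gamma> @ \<Delta>) (Lolli A B)
      (curry_arr (act (obs (\<Gamma> @ \<Delta>)) (stoup_ob (Some (Lolli A' B')))) (ob A)
        (m \<bullet> actm (obs (\<Delta> @ [A])) ?e))"
    using denotes.lolliL[OF lm] by (intro denotes.lolliR) simp
  with denotes.lolliL[OF lm(1) denotes.lolliR[OF lm(2)]] show ?case
    using denotes_arrow[OF lm(1)] denotes_arrow[OF lm(2)] by (auto simp: curry_comp)
next
  case (tensR_IL f \<Gamma> A g \<Delta> B)
  then obtain m k where mk: "denotes f None \<Gamma> A m" "denotes g None \<Delta> B k"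
    using derives_denotes by metis
  show ?case
    using denotes.tensR[OF denotes.IL[OF mk(1)] mk(2)] denotes.IL[OF denotes.tensR[OF mk]] by auto
next
  case (tensR_tensL f A' B' \<Gamma> A g \<Delta> B)
  then obtain m k where mk: "denotes f (Some A') (B' # \<Gamma>) A m" "denotes g None \<Delta> B k"
    using derives_denotes by metis
  show ?case
    using denotes.tensR[OF denotes.tensL[OF mk(1)] mk(2)]
      denotes.tensL[OF denotes.tensR[OF mk, simplified]] by auto
next
  case (IL_lolliR f \<Gamma> A B)
  then obtain m where m: "denotes f None (\<Gamma> @ [A]) B m"
    using derives_denotes by metis
  show ?case
    using denotes.lolliR[OF denotes.IL[OF m]] denotes.IL[OF denotes.lolliR[OF m]] by auto
next
  case (tensL_lolliR f A' B' \<Gamma> A B)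
  then obtain m where m: "denotes f (Some A') (B' # \<Gamma> @ [A]) B m"
    using derives_denotes by metis
  show ?case
    using denotes.lolliR[OF denotes.tensL[OF m]] denotes.tensL[OF denotes.lolliR[OF m[folded append_Cons]]]
    by auto
next
  case (cong_tensR S \<Gamma> A f f' \<Delta> B g g')
  then show ?case using denotes.tensR by blast
next
  case (cong_lolliL \<Gamma> A f f' B \<Delta> E g g')
  then show ?case using denotes.lolliL by blast
next
  case ax_Unit
  then show ?case using denotes.ax[of Unit] denotes.IL[OF denotes.IR] by auto
qed (blast intro: denotes.pass denotes.lolliR denotes.IL denotes.tensL)+

section \<open>Structural laws and the functor on classes\<close>

lemma denotes_Lam: "denotes (TensL (IL (Pass (Ax A)))) (Some (Tens Unit A)) [] A (lam (ob A))"
  using denotes.tensL[OF denotes.IL[OF denotes.pass[OF denotes.ax]]] by simp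

lemma denotes_Rho: "denotes (TensR (Ax A) IR) (Some A) [] (Tens A Unit) (rho (ob A))"
  using denotes.tensR[OF denotes.ax denotes.IR] by simp

text \<open>\<open>psi_singleton_lam\<close> reduces the inner pair to an identity;
  \<open>psi_Cons_lam\<close> then leaves \<open>strength\<close> along one formula, a single
  \<open>alpha\<close>.\<close>

lemma denotes_Alpha:
  "denotes (TensL (TensL (TensR (Ax A) (Pass (TensR (Ax B) (Pass (Ax D)))))))
    (Some (Tens (Tens A B) D)) [] (Tens A (Tens B D)) (alpha (ob A) (ob B) (ob D))"
proof -
  have "denotes (TensR (Ax B) (Pass (Ax D))) (Some B) [D] (Tens B D) (ident (ob B \<otimes> ob D))"
    using denotes.tensR[OF denotes.ax[of B] denotes.pass[OF denotes.ax[of D]]]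
    by (simp add: psi_singleton_lam)
  from denotes.tensR[OF denotes.ax[of A] denotes.pass[OF this]]
  have "denotes (TensR (Ax A) (Pass (TensR (Ax B) (Pass (Ax D))))) (Some A) [B, D] (Tens A (Tens B D))
      (alpha (ob A) (ob B) (ob D))"
    using psi_Cons_lam[of "ob A" "ob B" "[ob D]"] by simp
  then show ?thesis
    by (intro denotes.tensL)
qed

text \<open>The sequent is quantified away because any member of the class determines it, by
  \<open>denotes_unique\<close>.\<close>

definition Fm :: "'x deriv set \<Rightarrow> 'b" where
  "Fm X = raw (THE m. \<exists>f\<in>X. \<exists>S \<Gamma> E. denotes f S \<Gamma> E m)"

text \<open>
  The operations of \<open>FSkMCl At\<close> are unions of classes, all of whose members have the same denotation.
  Hence \<open>Fm\<close> can be computed on them without knowing that cut is compatible with \<open>ceq\<close>.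
\<close>

lemma Fm_eqI: "\<lbrakk>X \<noteq> {}; \<And>f. f \<in> X \<Longrightarrow> denotes f S \<Gamma> E m\<rbrakk> \<Longrightarrow> Fm X = raw m"
  unfolding Fm_def by (rule arg_cong[of _ _ raw], rule the_equality) (blast dest: denotes_unique)+

lemma cls_self: "denotes f S \<Gamma> E m \<Longrightarrow> f \<in> cls f"
  unfolding cls_def ceq_rel_def by (blast intro: ceq.refl dest: denotes_derives)

lemma denotes_cls: "\<lbrakk>denotes f S \<Gamma> E m; f' \<in> cls f\<rbrakk> \<Longrightarrow> denotes f' S \<Gamma> E m"
  unfolding cls_def ceq_rel_def by (blast dest: ceq_denotes denotes_unique)

lemma Fm_cls: "denotes f S \<Gamma> E m \<Longrightarrow> Fm (cls f) = raw m"
  using cls_self denotes_cls by (intro Fm_eqI) blast+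

text \<open>The union ranges over all pairs of representatives, hence the demand on \<open>h\<close>
  for every \<open>f'\<close> and \<open>g'\<close> that share the denotations of \<open>f\<close>
  and \<open>g\<close>.\<close>

lemma Fm_lift2:
  assumes "denotes f S \<Gamma> A m" "denotes g T \<Delta> B k"
    and h: "\<And>f' g'. \<lbrakk>denotes f' S \<Gamma> A m; denotes g' T \<Delta> B k\<rbrakk> \<Longrightarrow> denotes (h f' g') U \<Lambda> E l"
  shows "Fm (lift2 h (cls f) (cls g)) = raw l"
proof (rule Fm_eqI)
  show "lift2 h (cls f) (cls g) \<noteq> {}"
    unfolding lift2_def using cls_self[OF assms(1)] cls_self[OF assms(2)] cls_self[OF h[OF assms(1,2)]] by blast
  show "e \<in> lift2 h (cls f) (cls g) \<Longrightarrow> denotes e U \<Lambda> E l" for e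
    unfolding lift2_def using denotes_cls[OF h[OF denotes_cls[OF assms(1)] denotes_cls[OF assms(2)]]] by blast
qed

lemma Hom_FSkMClE:
  assumes "X \<in> Hom (FSkMCl At) A B"
  obtains f m where "X = cls f" "denotes f (Some A) [] B m"
proof -
  from assms obtain f where "derives f (Some A) [] B" "X = cls f"
    by (auto simp: FSkMCl_def cls_def elim: quotientE)
  with that derives_denotes show ?thesis by blast
qed

lemma raw_simps:
  "raw (g \<bullet> f) = raw g \<cdot> raw f" "raw (ident A) = Id C A" "raw (f \<star> g) = raw f \<otimes>\<^sub>m raw g"
  "raw (lolli_arr f g) = raw f -\<circ>\<^sub>m raw g" "raw (lam A) = Lam C A" "raw (rho A) = Rho C A"
  "raw (alpha A B D) = Alpha C A B D"
  by (simp_all add: comp_def ident_def tens_def lolli_arr_def lam_def rho_def alpha_def)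

lemma strict_functor: "strict_skew_monoidal_closed_functor (FSkMCl At) C ob Fm"
proof -
  have hom: "Fm X \<in> Hom C (ob A) (ob B)" if "X \<in> Hom (FSkMCl At) A B" for X A B
    using that by (elim Hom_FSkMClE) (use denotes_arrow in \<open>fastforce simp: Fm_cls arrow_def\<close>)
  have comp: "Fm (lift2 (\<lambda>g f. scut f g) Y X) = Fm Y \<cdot> Fm X"
    if X: "X \<in> Hom (FSkMCl At) A B" and Y: "Y \<in> Hom (FSkMCl At) B E" for X Y A B E
  proof -
    from X Y obtain f m g k where fg: "X = cls f" "Y = cls g" "denotes f (Some A) [] B m"
      "denotes g (Some B) [] E k" by (metis Hom_FSkMClE)
    \<comment> \<open>With empty contexts \<open>actm\<close> is trivial, so the cut denotes plain
      composition.\<close>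
    have "denotes (scut f' g') (Some A) [] E (k \<bullet> m)"
      if "denotes g' (Some B) [] E k" "denotes f' (Some A) [] B m" for f' g'
      using denotes_scut[OF that(2,1)] by simp
    from Fm_lift2[of g _ _ _ _ f _ _ _ _ "\<lambda>g f. scut f g", OF fg(4,3) this] fg show ?thesis
      by (simp add: Fm_cls raw_simps)
  qed
  have tens: "Fm (lift2 (\<lambda>f g. TensL (TensR f (Pass g))) X Y) = Fm X \<otimes>\<^sub>m Fm Y"
    if X: "X \<in> Hom (FSkMCl At) A A'" and Y: "Y \<in> Hom (FSkMCl At) B B'" for X Y A A' B B'
  proof -
    from X Y obtain f m g k where fg: "X = cls f" "Y = cls g" "denotes f (Some A) [] A' m"
      "denotes g (Some B) [] B' k" by (metis Hom_FSkMClE)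
    then show ?thesis
      using Fm_lift2[OF fg(3,4) denotes_tens] by (simp add: Fm_cls raw_simps)
  qed
  have lolli: "Fm (lift2 (\<lambda>f g. LolliR (LolliL (Pass f) g)) X Y) = Fm X -\<circ>\<^sub>m Fm Y"
    if X: "X \<in> Hom (FSkMCl At) A' A" and Y: "Y \<in> Hom (FSkMCl At) B B'" for X Y A A' B B'
  proof -
    from X Y obtain f m g k where fg: "X = cls f" "Y = cls g" "denotes f (Some A') [] A m"
      "denotes g (Some B) [] B' k" by (metis Hom_FSkMClE)
    then show ?thesis
      using Fm_lift2[OF fg(3,4) denotes_lolli] by (simp add: Fm_cls raw_simps)
  qed
  have ops: "Id (FSkMCl At) A = cls (Ax A)" "Comp (FSkMCl At) = lift2 (\<lambda>g f. scut f g)"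
    "UnitO (FSkMCl At) = Unit" "TensO (FSkMCl At) = Tens" "LolliO (FSkMCl At) = Lolli"
    "TensM (FSkMCl At) = lift2 (\<lambda>f g. TensL (TensR f (Pass g)))"
    "LolliM (FSkMCl At) = lift2 (\<lambda>f g. LolliR (LolliL (Pass f) g))"
    "Lam (FSkMCl At) A = cls (TensL (IL (Pass (Ax A))))" "Rho (FSkMCl At) A = cls (TensR (Ax A) IR)"
    "Alpha (FSkMCl At) A B D = cls (TensL (TensL (TensR (Ax A) (Pass (TensR (Ax B) (Pass (Ax D)))))))"
    for A B D
    by (simp_all add: FSkMCl_def)
  show ?thesis
    unfolding strict_skew_monoidal_closed_functor_def ops
    by (intro conjI ballI)
       (simp_all add: hom comp tens lolli raw_simps
         Fm_cls[OF denotes.ax] Fm_cls[OF denotes_Lam] Fm_cls[OF denotes_Rho] Fm_cls[OF denotes_Alpha])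
qed

end

section \<open>From an evaluation of atoms to a strict functor\<close>

theorem theorem3p1:
  fixes D :: "('o, 'm) skmc" and At :: "'x set" and F_At :: "'x \<Rightarrow> 'o"
  assumes "skew_monoidal_closed_category D"
    and "\<forall>X\<in>At. F_At X \<in> Obj D"
  shows "\<exists>Fo Fm. strict_skew_monoidal_closed_functor (FSkMCl At) D Fo Fm \<and>
           (\<forall>X\<in>At. Fo (Atom X) = F_At X)"
proof -
  interpret skew_monoidal_closed_category D by fact
  \<comment> \<open>atoms outside \<open>At\<close> get a junk value, so that every formula denotes an object\<close>
  let ?v = "\<lambda>X. if X \<in> At then F_At X else UnitO D"
  interpret fma_interpretation D ?v
    by unfold_locales (use assms(2) in auto)
  show ?thesis
    using strict_functor[of At] by (intro exI[of _ ob] exI[of _ Fm]) simp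
qed

end
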